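(* Let $\mathfrak S$ be an arbitrary finite subset of $\mathbb Z^2$, $K(x,y;t)=1-t\sum_{(i,j)\in\mathfrak S}x^iy^j$, and $B(x;t)$ the generating function of bilateral walks with steps in $\mathfrak S$, with canonical factorization $(B_0(t),B_+(x;t),B_-(\bar x;t))$. Then the generating functions $L(t)$ of loops, $S_0(x;t)$ of bilateral walks on the slit plane, and $S(x,y;t)$ of walks on the slit plane (all with steps in $\mathfrak S$) are $$L(t)=B_0(t),\qquad S_0(x;t)=B_+(x;t),\qquad S(x,y;t)=\frac{1}{K(x,y;t)B_0(t)B_-(\bar x;t)}.$$ The logarithm of each of these series is D-finite.
   Context: A walk with steps in $\mathfrak S$ is a sequence $(w_0,\dots,w_n)$ of points of $\mathbb Z^2$ with $w_0=(0,0)$ and $w_k-w_{k-1}\in\mathfrak S$; $n$ is its length. It is on the slit plane if none of $w_1,\dots,w_n$ lies on $\mathcal H=\{(k,0):k\le0\}$; bilateral if $w_n$ lies on the $x$-axis; a loop if $w_n=(0,0)$ and no $w_k$ lies on $\{(k,0):k<0\}$. The generating function of a set of walks is $\sum_nt^n\sum_{i,j}a_{i,j}(n)x^iy^j$, $a_{i,j}(n)$ being the number of its walks of length $n$ ending at $(i,j)$ ($y$ omitted for walks ending on the $x$-axis, only $t$ kept for loops); $\bar x=1/x$. Canonical factorization: for a power series $B(x;t)$ in $t$ with coefficients in $\mathbb R[x,\bar x]$ and $B(x;0)=1$, there is a unique triple of formal power series in $t$ with $B=B_0(t)B_+(x;t)B_-(\bar x;t)$, where $B_0$ has real coefficients,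 $B_+$ has coefficients in $\mathbb R[x]$, $B_-$ has coefficients in $\mathbb R[\bar x]$, and $B_0(0)=B_+(x;0)=B_-(\bar x;0)=B_+(0;t)=B_-(0;t)=1$. A series is D-finite if its partial derivatives span a finite-dimensional vector space over the field of rational functions in its variables. *)

theory Defs
  imports
    Complex_Main
    "HOL-Library.Poly_Mapping"
    "HOL-Library.Product_Plus"
    "HOL-Computational_Algebra.Computational_Algebra"
begin

text \<open>
  The ring of Laurent polynomials over a ring \<open>'a\<close> is the group algebra \<open>int \<Rightarrow>\<^sub>0 'a\<close>, where
  \<open>Poly_Mapping.single k c\<close> is the monomial with exponent \<open>k\<close> and coefficient \<open>c\<close>.
  Series in \<open>t\<close> with coefficients in \<open>\<real>[x, 1/x]\<close> have type \<open>real laurent fps\<close>, and series in \<open>t\<close>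
  with coefficients in \<open>\<real>[x, 1/x, y, 1/y]\<close> have type \<open>real laurent laurent fps\<close>: the outer
  exponent is that of \<open>y\<close>, the inner one that of \<open>x\<close>.
\<close>

type_synonym 'a laurent = "int \<Rightarrow>\<^sub>0 'a"

definition fps_map :: "('a \<Rightarrow> 'b) \<Rightarrow> 'a fps \<Rightarrow> 'b fps" where
  "fps_map h f = Abs_fps (\<lambda>n. h (fps_nth f n))"

definition laurent_const :: "'a::zero \<Rightarrow> 'a laurent" where
  "laurent_const c = Poly_Mapping.single 0 c"

definition fps_lift :: "'a::zero fps \<Rightarrow> 'a laurent fps" where
  "fps_lift = fps_map laurent_const"


subsection \<open>Walks\<close>

definition walks :: "(int \<times> int) set \<Rightarrow> (int \<times> int) list set" where
  "walks \<SS> = {w. w \<noteq> [] \<and> w ! 0 = (0, 0) \<and> (\<forall>k\<in>{1..<length w}. w ! k - w ! (k - 1) \<in> \<SS>)}"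

definition walk_length :: "(int \<times> int) list \<Rightarrow> nat" where
  "walk_length w = length w - 1"

definition on_slit_plane :: "(int \<times> int) list \<Rightarrow> bool" where
  "on_slit_plane w \<longleftrightarrow> (\<forall>k\<in>{1..walk_length w}. w ! k \<notin> {(i, 0) | i. i \<le> 0})"

definition bilateral :: "(int \<times> int) list \<Rightarrow> bool" where
  "bilateral w \<longleftrightarrow> snd (last w) = 0"

definition is_loop :: "(int \<times> int) list \<Rightarrow> bool" where
  "is_loop w \<longleftrightarrow> last w = (0, 0) \<and> (\<forall>k\<in>{0..walk_length w}. w ! k \<notin> {(i, 0) | i. i < 0})"

definition bilateral_walks :: "(int \<times> int) set \<Rightarrow> (int \<times> int) list set" where
  "bilateral_walks \<SS> = {w \<in> walks \<SS>. bilateral w}"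

definition loops :: "(int \<times> int) set \<Rightarrow> (int \<times> int) list set" where
  "loops \<SS> = {w \<in> walks \<SS>. is_loop w}"

definition slit_walks :: "(int \<times> int) set \<Rightarrow> (int \<times> int) list set" where
  "slit_walks \<SS> = {w \<in> walks \<SS>. on_slit_plane w}"

definition bilateral_slit_walks :: "(int \<times> int) set \<Rightarrow> (int \<times> int) list set" where
  "bilateral_slit_walks \<SS> = {w \<in> walks \<SS>. on_slit_plane w \<and> bilateral w}"


subsection \<open>Generating functions\<close>

definition num_walks :: "(int \<times> int) list set \<Rightarrow> nat \<Rightarrow> int \<times> int \<Rightarrow> nat" where
  "num_walks W n p = card {w \<in> W. walk_length w = n \<and> last w = p}"

definition gf_xy :: "(int \<times> int) list set \<Rightarrow> real laurent laurent fps" where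
  "gf_xy W = Abs_fps (\<lambda>n. \<Sum>(i, j) | num_walks W n (i, j) \<noteq> 0.
     Poly_Mapping.single j (Poly_Mapping.single i (real (num_walks W n (i, j)))))"

text \<open>The next two are meant for walks ending on the \<open>x\<close>-axis and at the origin, respectively.\<close>

definition gf_x :: "(int \<times> int) list set \<Rightarrow> real laurent fps" where
  "gf_x W = Abs_fps (\<lambda>n. \<Sum>i | num_walks W n (i, 0) \<noteq> 0.
     Poly_Mapping.single i (real (num_walks W n (i, 0))))"

definition gf_t :: "(int \<times> int) list set \<Rightarrow> real fps" where
  "gf_t W = Abs_fps (\<lambda>n. real (num_walks W n (0, 0)))"

definition walk_kernel :: "(int \<times> int) set \<Rightarrow> real laurent laurent fps" where
  "walk_kernel \<SS> = 1 - fps_X * fps_const (\<Sum>(i, j)\<in>\<SS>. Poly_Mapping.single j (Poly_Mapping.single i 1))"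


subsection \<open>Canonical factorization\<close>

text \<open>
  The factor \<open>Bm\<close> is the series \<open>B\<^sub>-(1/x; t)\<close>, written as a series in \<open>x\<close> and \<open>t\<close> with nonpositive
  exponents of \<open>x\<close>. Hence both \<open>B\<^sub>+(0; t)\<close> and \<open>B\<^sub>-(0; t)\<close> are obtained by extracting the coefficient
  of \<open>x\<^sup>0\<close>.
\<close>

definition canonical_factorization ::
    "real laurent fps \<Rightarrow> real fps \<Rightarrow> real laurent fps \<Rightarrow> real laurent fps \<Rightarrow> bool" where
  "canonical_factorization B B0 Bp Bm \<longleftrightarrow>
     B = fps_lift B0 * Bp * Bm \<and>
     (\<forall>n. Poly_Mapping.keys (fps_nth Bp n) \<subseteq> {0..}) \<and>
     (\<forall>n. Poly_Mapping.keys (fps_nth Bm n) \<subseteq> {..0}) \<and>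
     fps_nth B0 0 = 1 \<and> fps_nth Bp 0 = 1 \<and> fps_nth Bm 0 = 1 \<and>
     fps_map (\<lambda>p. Poly_Mapping.lookup p 0) Bp = 1 \<and>
     fps_map (\<lambda>p. Poly_Mapping.lookup p 0) Bm = 1"


subsection \<open>Logarithm\<close>

text \<open>
  For a series \<open>f\<close> with constant coefficient 1, this is the sum over \<open>n \<ge> 1\<close> of
  \<open>(-1)^(n-1) (f - 1)^n / n\<close>. The argument \<open>\<iota>\<close> embeds the reals into the ring of coefficients.
\<close>

definition fps_log :: "(real \<Rightarrow> 'a::comm_ring_1) \<Rightarrow> 'a fps \<Rightarrow> 'a fps" where
  "fps_log \<iota> f = fps_compose (fps_map \<iota> (fps_ln 1)) (f - 1)"


subsection \<open>D-finite series\<close>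

definition laurent_deriv :: "'a::comm_ring_1 laurent \<Rightarrow> 'a laurent" where
  "laurent_deriv p = (\<Sum>k\<in>Poly_Mapping.keys p.
     Poly_Mapping.single (k - 1) (of_int k * Poly_Mapping.lookup p k))"

inductive_set iterated_derivs :: "('b \<Rightarrow> 'b) set \<Rightarrow> 'b \<Rightarrow> 'b set" for \<Delta> f where
  base: "f \<in> iterated_derivs \<Delta> f"
| step: "g \<in> iterated_derivs \<Delta> f \<Longrightarrow> \<delta> \<in> \<Delta> \<Longrightarrow> \<delta> g \<in> iterated_derivs \<Delta> f"

text \<open>
  For \<open>'a\<close> one of \<open>real\<close>, \<open>real laurent\<close>, \<open>real laurent laurent\<close>, the field \<open>'a poly fract\<close> is
  \<open>\<real>(t)\<close>, \<open>\<real>(x, t)\<close>, \<open>\<real>(x, y, t)\<close>, as a Laurent polynomial is a polynomial divided by a monomial.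
  It acts on the fraction field of the ring of series \<open>'a fps\<close>.
\<close>

definition ratfun_embed :: "'a::idom poly fract \<Rightarrow> 'a fps fract" where
  "ratfun_embed r = (THE u. \<exists>p q. q \<noteq> 0 \<and> r = Fract p q \<and> u = Fract (fps_of_poly p) (fps_of_poly q))"

lemma fps_of_poly_nonzero: "q \<noteq> 0 \<Longrightarrow> fps_of_poly q \<noteq> 0"
  using fps_of_poly_eq_iff[of q 0] by simp

lemma ratfun_embed_Fract:
  fixes p q :: "'a::idom poly"
  assumes "q \<noteq> 0"
  shows "ratfun_embed (Fract p q) = Fract (fps_of_poly p) (fps_of_poly q)"
  unfolding ratfun_embed_def
proof (rule the_equality)
  fix u
  assume "\<exists>p' q'. q' \<noteq> 0 \<and> Fract p q = Fract p' q' \<and> u = Fract (fps_of_poly p') (fps_of_poly q')"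
  then obtain p' q' where *: "q' \<noteq> 0" "Fract p q = Fract p' q'"
      "u = Fract (fps_of_poly p') (fps_of_poly q')"
    by blast
  have "p * q' = p' * q"
    using * assms by (simp add: eq_fract)
  then have "fps_of_poly p * fps_of_poly q' = fps_of_poly p' * fps_of_poly q"
    by (metis fps_of_poly_mult)
  then show "u = Fract (fps_of_poly p) (fps_of_poly q)"
    using * assms by (simp add: eq_fract fps_of_poly_nonzero)
qed (use assms in blast)

lemma ratfun_embed_1: "ratfun_embed 1 = 1"
  using ratfun_embed_Fract[of 1 1] by (simp add: One_fract_def)

lemma ratfun_embed_add: "ratfun_embed (a + b) = ratfun_embed a + ratfun_embed b"
  by (cases a; cases b)
    (simp add: ratfun_embed_Fract fps_of_poly_nonzero fps_of_poly_mult fps_of_poly_add)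

lemma ratfun_embed_mult: "ratfun_embed (a * b) = ratfun_embed a * ratfun_embed b"
  by (cases a; cases b)
    (simp add: ratfun_embed_Fract fps_of_poly_nonzero fps_of_poly_mult)

definition ratfun_scale :: "'a::idom poly fract \<Rightarrow> 'a fps fract \<Rightarrow> 'a fps fract" where
  "ratfun_scale r u = ratfun_embed r * u"

global_interpretation ratfun: vector_space ratfun_scale
  by unfold_locales
    (simp_all add: ratfun_scale_def ratfun_embed_1 ratfun_embed_add ratfun_embed_mult algebra_simps)

text \<open>The set \<open>\<Delta>\<close> consists of the partial derivations with respect to each of the variables.\<close>

definition D_finite :: "('a fps \<Rightarrow> 'a fps) set \<Rightarrow> 'a::idom fps \<Rightarrow> bool" where
  "D_finite \<Delta> f \<longleftrightarrow>
     (\<exists>G. finite G \<and> ratfun.span ((\<lambda>g. Fract g 1) ` iterated_derivs \<Delta> f) = ratfun.span G)"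

definition D_finite_t :: "real fps \<Rightarrow> bool" where
  "D_finite_t = D_finite {fps_deriv}"

definition D_finite_xt :: "real laurent fps \<Rightarrow> bool" where
  "D_finite_xt = D_finite {fps_deriv, fps_map laurent_deriv}"

definition D_finite_xyt :: "real laurent laurent fps \<Rightarrow> bool" where
  "D_finite_xyt =
     D_finite {fps_deriv, fps_map laurent_deriv, fps_map (Poly_Mapping.map laurent_deriv)}"

end

theory Submission
  imports Defs "HOL-Library.Function_Algebras" "HOL-Algebra.Algebraic_Closure_Type"
begin

text \<open>
  Let \<open>H\<close> be a subset of the \<open>x\<close>-axis, and let \<open>F\<close> count the walks that avoid \<open>H\<close> after their start.
  Appending a step gives \<open>F K = 1 - T\<close>, where \<open>T\<close> is supported on \<open>H\<close>, so \<open>F = (1 - T)/K\<close>, and on the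
  axis \<open>F\<^sub>0 = (1 - T) B\<close>. For \<open>H\<close> the closed or the open half line, comparing the signs of the exponents
  of \<open>x\<close> with \<open>B = B\<^sub>0 B\<^sub>+ B\<^sub>-\<close> yields the three formulas.

  For D-finiteness, write \<open>K = K\<^sub>- K\<^sub>+\<close> with factors in nonpositive and nonnegative powers of \<open>y\<close>.
  Since \<open>1/K = 1 - t K'/K\<close>, the series \<open>B\<close> is \<open>1 - t k'/k\<close>, where \<open>k\<close> is the constant coefficient of
  \<open>K\<^sub>+\<close>. Up to a factor in \<open>\<real>(x, t)\<close>, it is a product of roots of a polynomial over \<open>\<real>(x, t)\<close>,
  hence algebraic. So the derivatives of \<open>log B\<close> lie in a finite extension of \<open>\<real>(x, t)\<close>. By
  Lipshitz' counting argument the coefficients of \<open>log B\<close> in \<open>x\<close> are D-finite in \<open>t\<close>. Taking the part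
  with nonnegative exponents of \<open>x\<close> commutes with differential operators up to finitely many of
  these coefficients. The parts of \<open>log B\<close> are the logarithms of \<open>B\<^sub>0\<close>, \<open>B\<^sub>+\<close> and \<open>B\<^sub>-\<close>.
\<close>

hide_const (open)
  UnivPoly.coeff UnivPoly.monom Module.smult Polynomials.degree Polynomials.lead_coeff

subsection \<open>Ring homomorphisms and derivations\<close>

locale comm_ring_hom =
  fixes hom :: "'a::comm_ring_1 \<Rightarrow> 'b::comm_ring_1"
  assumes hom_add: "hom (x + y) = hom x + hom y"
    and hom_mult: "hom (x * y) = hom x * hom y"
    and hom_1 [simp]: "hom 1 = 1"
begin

lemma hom_0 [simp]: "hom 0 = 0"
  using hom_add[of 0 0] by simp

lemma hom_uminus: "hom (- x) = - hom x"
  using hom_add[of "- x" x] by (simp add: eq_neg_iff_add_eq_0)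

lemma hom_diff: "hom (x - y) = hom x - hom y"
  using hom_add[of x "- y"] by (simp add: hom_uminus)

lemma hom_sum: "hom (sum f A) = (\<Sum>i\<in>A. hom (f i))"
  by (induction A rule: infinite_finite_induct) (simp_all add: hom_add)

lemma hom_power: "hom (x ^ n) = hom x ^ n"
  by (induction n) (simp_all add: hom_mult)

lemma hom_of_nat: "hom (of_nat n) = of_nat n"
  by (induction n) (simp_all add: hom_add)

lemma hom_poly: "hom (poly p x) = poly (map_poly hom p) (hom x)"
  by (induction p) (simp_all add: map_poly_pCons hom_add hom_mult)

lemma map_poly_hom_mult: "map_poly hom (p * q) = map_poly hom p * map_poly hom q"
  by (rule poly_eqI) (simp add: coeff_map_poly coeff_mult hom_sum hom_mult)

end

locale derivation =
  fixes \<delta> :: "'a::comm_ring_1 \<Rightarrow> 'a"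
  assumes add: "\<delta> (a + b) = \<delta> a + \<delta> b"
    and mult: "\<delta> (a * b) = \<delta> a * b + a * \<delta> b"
begin

lemma zero [simp]: "\<delta> 0 = 0"
  using add[of 0 0] by simp

lemma one [simp]: "\<delta> 1 = 0"
  using mult[of 1 1] by simp

lemma sum: "\<delta> (sum f A) = (\<Sum>i\<in>A. \<delta> (f i))"
  by (induction A rule: infinite_finite_induct) (simp_all add: add)

lemma of_nat_mult: "\<delta> (of_nat n * a) = of_nat n * \<delta> a"
  by (induction n) (simp_all add: add distrib_right)

lemma power: "\<delta> (a ^ n) = of_nat n * a ^ (n - 1) * \<delta> a"
proof (induction n)
  case (Suc n)
  then show ?case
    by (cases n) (simp_all add: mult algebra_simps)
qed simp

end

lemma derivation_poly:
  fixes \<delta> :: "'a::idom \<Rightarrow> 'a"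
  assumes "derivation \<delta>"
  shows "\<delta> (poly p x) = poly (map_poly \<delta> p) x + poly (pderiv p) x * \<delta> x"
proof -
  interpret derivation \<delta> by fact
  show ?thesis
    by (induction p) (simp_all add: add mult map_poly_pCons pderiv_pCons algebra_simps)
qed


subsection \<open>Linear dependence\<close>

lemma (in vector_space) dependent_family:
  assumes "finite I" "finite T" "f ` I \<subseteq> span T" "card T < card I"
  obtains c where "\<exists>i\<in>I. c i \<noteq> 0" "(\<Sum>i\<in>I. scale (c i) (f i)) = 0"
proof (cases "inj_on f I")
  case True
  then have "dependent (f ` I)"
    using independent_span_bound[OF assms(2) _ assms(3)] assms(4) by (fastforce simp: card_image)
  then obtain u where "\<exists>v\<in>f ` I. u v \<noteq> 0" "(\<Sum>v\<in>f ` I. scale (u v) v) = 0"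
    using assms(1) by (auto simp: dependent_finite)
  then show ?thesis
    using that[of "\<lambda>i. u (f i)"] by (simp add: sum.reindex[OF True])
next
  case False
  then obtain k l where "k \<in> I" "l \<in> I" "k \<noteq> l" and collision: "f k = f l"
    by (auto simp: inj_on_def)
  define c where "c i = (if i = k then 1 else if i = l then - 1 else 0 :: 'a)" for i
  have "(\<Sum>i\<in>I. scale (c i) (f i)) = (\<Sum>i\<in>{k, l}. scale (c i) (f i))"
    using \<open>k \<in> I\<close> \<open>l \<in> I\<close> assms(1) by (intro sum.mono_neutral_right) (auto simp: c_def)
  also have "\<dots> = 0"
    using \<open>k \<noteq> l\<close> by (simp add: c_def collision)
  finally have "(\<Sum>i\<in>I. scale (c i) (f i)) = 0" .
  moreover have "c k \<noteq> 0" by (simp add: c_def)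
  ultimately show ?thesis
    using that \<open>k \<in> I\<close> by blast
qed

lemma homogeneous_system_nontrivial:
  fixes a :: "'i \<Rightarrow> 'j \<Rightarrow> 'k::field"
  assumes "finite I" "finite J" "card J < card I"
  obtains c where "\<exists>i\<in>I. c i \<noteq> 0" "\<And>j. j \<in> J \<Longrightarrow> (\<Sum>i\<in>I. c i * a i j) = 0"
proof -
  interpret vs: vector_space "\<lambda>c (f :: 'j \<Rightarrow> 'k) j. c * f j"
    by unfold_locales (auto simp: algebra_simps)
  define row where "row i = (\<lambda>j. if j \<in> J then a i j else 0)" for i
  define unit where "unit k = (\<lambda>j. if j = k then 1 else 0 :: 'k)" for k :: 'j
  have sum_apply: "(\<Sum>x\<in>A. f x) j = (\<Sum>x\<in>A. f x j)" for A :: "'b set" and f :: "'b \<Rightarrow> 'j \<Rightarrow> 'k" and j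
    by (induction A rule: infinite_finite_induct) auto
  have "row i \<in> vs.span (unit ` J)" for i
  proof -
    have "row i = (\<Sum>k\<in>J. (\<lambda>j. a i k * unit k j))"
      using assms(2) by (auto simp: row_def unit_def sum_apply if_distrib cong: if_cong)
    also have "\<dots> \<in> vs.span (unit ` J)"
      by (intro vs.span_sum vs.span_scale vs.span_base imageI)
    finally show ?thesis .
  qed
  moreover have "card (unit ` J) < card I"
    using card_image_le[OF assms(2), of unit] assms(3) by simp
  ultimately obtain c where nonzero: "\<exists>i\<in>I. c i \<noteq> 0" and relation: "(\<Sum>i\<in>I. (\<lambda>j. c i * row i j)) = 0"
    using vs.dependent_family[of I "unit ` J" row] assms(1,2) by blast
  have "(\<Sum>i\<in>I. c i * a i j) = 0" if "j \<in> J" for j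
    using fun_cong[OF relation, of j] that by (simp add: sum_apply row_def)
  with nonzero show ?thesis by (rule that)
qed


subsection \<open>Algebraic elements of field extensions\<close>

locale field_embedding = comm_ring_hom hom
  for hom :: "'k::field \<Rightarrow> 'l::field"
begin

sublocale vs: vector_space "\<lambda>c u. hom c * u"
  by unfold_locales (simp_all add: hom_add hom_mult algebra_simps)

lemma hom_eq_0_iff: "hom a = 0 \<longleftrightarrow> a = 0"
proof
  assume "hom a = 0"
  then show "a = 0"
    using hom_mult[of a "inverse a"] by (cases "a = 0") auto
qed simp

lemma hom_inverse: "hom (inverse a) = inverse (hom a)"
proof (cases "a = 0")
  case False
  then have "hom a * hom (inverse a) = 1"
    by (simp add: hom_mult[symmetric])
  then show ?thesis
    by (metis inverse_unique)
qed simp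

lemma span_mult:
  assumes "x \<in> vs.span A" "y \<in> vs.span B" "\<And>a b. a \<in> A \<Longrightarrow> b \<in> B \<Longrightarrow> a * b \<in> vs.span C"
  shows "x * y \<in> vs.span C"
proof -
  have subspace: "vs.subspace {u. u * v \<in> vs.span C}" for v
    by (rule vs.subspaceI)
       (auto simp: distrib_right mult.assoc vs.span_zero vs.span_add vs.span_scale)
  have "a * y \<in> vs.span C" if "a \<in> A" for a
  proof -
    have "b * a \<in> vs.span C" if "b \<in> B" for b
      using assms(3)[OF \<open>a \<in> A\<close> that] by (simp add: mult.commute)
    then show ?thesis
      using vs.span_minimal[OF _ subspace, of B a] assms(2) by (auto simp: mult.commute[of a])
  qed
  then show ?thesis
    using vs.span_minimal[OF _ subspace, of A y] assms(1) by auto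
qed

definition is_algebraic :: "'l \<Rightarrow> bool" where
  "is_algebraic u \<longleftrightarrow> (\<exists>p. p \<noteq> 0 \<and> poly (map_poly hom p) u = 0)"

definition finite_algebra :: "'l set \<Rightarrow> bool" where
  "finite_algebra G \<longleftrightarrow> finite G \<and> 1 \<in> vs.span G \<and> (\<forall>g\<in>G. \<forall>h\<in>G. g * h \<in> vs.span G)"

lemma finite_algebra_mult:
  "finite_algebra G \<Longrightarrow> x \<in> vs.span G \<Longrightarrow> y \<in> vs.span G \<Longrightarrow> x * y \<in> vs.span G"
  by (rule span_mult) (auto simp: finite_algebra_def)

lemma finite_algebra_power: "finite_algebra G \<Longrightarrow> u \<in> vs.span G \<Longrightarrow> u ^ n \<in> vs.span G"
  by (induction n) (auto simp: finite_algebra_def intro: finite_algebra_mult)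

lemma finite_algebra_poly:
  assumes "finite_algebra G" "u \<in> vs.span G"
  shows "poly (map_poly hom p) u \<in> vs.span G"
  unfolding poly_altdef
  by (intro vs.span_sum) (simp add: coeff_map_poly vs.span_scale finite_algebra_power[OF assms])

lemma is_algebraic_if_finite_algebra:
  assumes "finite_algebra G" "u \<in> vs.span G"
  shows "is_algebraic u"
proof -
  let ?n = "card G"
  have "(\<lambda>i. u ^ i) ` {..?n} \<subseteq> vs.span G"
    using finite_algebra_power[OF assms] by blast
  then obtain a where nonzero: "\<exists>i\<in>{..?n}. a i \<noteq> 0" and relation: "(\<Sum>i\<le>?n. hom (a i) * u ^ i) = 0"
    using vs.dependent_family[of "{..?n}" G "\<lambda>i. u ^ i"] assms(1) by (auto simp: finite_algebra_def)
  define p where "p = (\<Sum>i\<le>?n. monom (a i) i)"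
  have coeff_p: "coeff p i = (if i \<le> ?n then a i else 0)" for i
    by (simp add: p_def coeff_sum)
  have "map_poly hom p = (\<Sum>i\<le>?n. monom (hom (a i)) i)"
    by (rule poly_eqI) (simp add: coeff_map_poly coeff_p coeff_sum)
  then have "poly (map_poly hom p) u = 0"
    by (simp add: poly_sum poly_monom relation)
  moreover have "p \<noteq> 0"
    using nonzero coeff_p by (metis atMost_iff coeff_0)
  ultimately show ?thesis
    unfolding is_algebraic_def by blast
qed

lemma power_in_span_of_lower_powers:
  assumes "p \<noteq> 0" "poly (map_poly hom p) u = 0"
  shows "u ^ m \<in> vs.span ((\<lambda>i. u ^ i) ` {..<degree p})"
proof (induction m rule: less_induct)
  case (less m)
  let ?d = "degree p"
  show ?case
  proof (cases "m < ?d")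
    case True
    then show ?thesis by (intro vs.span_base) auto
  next
    case False
    then obtain e where m_eq: "m = ?d + e"
      using le_Suc_ex not_less by blast
    have "degree (map_poly hom p) = ?d"
      using assms(1) by (intro degree_map_poly) (simp add: hom_eq_0_iff)
    then have "hom (lead_coeff p) * u ^ ?d = - (\<Sum>i<?d. hom (coeff p i) * u ^ i)"
      using assms(2)
      by (simp add: poly_altdef coeff_map_poly lessThan_Suc_atMost[symmetric]
          eq_neg_iff_add_eq_0 add.commute)
    moreover have "u ^ ?d = hom (inverse (lead_coeff p)) * (hom (lead_coeff p) * u ^ ?d)"
      using assms(1) by (simp add: hom_inverse hom_eq_0_iff)
    ultimately have "u ^ ?d = hom (- inverse (lead_coeff p)) * (\<Sum>i<?d. hom (coeff p i) * u ^ i)"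
      by (simp add: hom_uminus)
    then have "u ^ m = hom (- inverse (lead_coeff p)) * (\<Sum>i<?d. hom (coeff p i) * u ^ (i + e))"
      by (simp add: m_eq power_add sum_distrib_right mult.assoc)
    also have "\<dots> \<in> vs.span ((\<lambda>i. u ^ i) ` {..<?d})"
      by (intro vs.span_scale vs.span_sum less) (simp add: m_eq)
    finally show ?thesis .
  qed
qed

lemma finite_algebra_powers:
  assumes "p \<noteq> 0" "poly (map_poly hom p) u = 0"
  shows "finite_algebra ((\<lambda>i. u ^ i) ` {..<degree p})"
  using power_in_span_of_lower_powers[OF assms, of 0] power_in_span_of_lower_powers[OF assms]
  by (auto simp: finite_algebra_def power_add[symmetric])

lemma is_algebraic_imp_finite_algebra:
  assumes "is_algebraic u"
  obtains n where "finite_algebra ((\<lambda>i. u ^ i) ` {..<n})" "u \<in> vs.span ((\<lambda>i. u ^ i) ` {..<n})"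
proof -
  obtain p where relation: "p \<noteq> 0" "poly (map_poly hom p) u = 0"
    using assms unfolding is_algebraic_def by blast
  show ?thesis
    using that finite_algebra_powers[OF relation] power_in_span_of_lower_powers[OF relation, of 1]
    by simp
qed

lemma is_algebraic_mult:
  assumes "is_algebraic u" "is_algebraic v"
  shows "is_algebraic (u * v)"
proof -
  obtain G where algebra_G: "finite_algebra G" "u \<in> vs.span G"
    using assms(1) by (rule is_algebraic_imp_finite_algebra)
  obtain H where algebra_H: "finite_algebra H" "v \<in> vs.span H"
    using assms(2) by (rule is_algebraic_imp_finite_algebra)
  define P where "P = (\<lambda>(g, h). g * h) ` (G \<times> H)"
  have products_in_span: "x * y \<in> vs.span P" if "x \<in> vs.span G" "y \<in> vs.span H" for x y
    using that by (rule span_mult) (auto simp: P_def intro!: vs.span_base)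
  have "finite_algebra P"
    unfolding finite_algebra_def
  proof (intro conjI ballI)
    show "finite P" "1 \<in> vs.span P"
      using algebra_G algebra_H products_in_span[of 1 1] by (auto simp: P_def finite_algebra_def)
    fix x y assume "x \<in> P" "y \<in> P"
    then obtain g h g' h' where
      "g \<in> G" "h \<in> H" "g' \<in> G" "h' \<in> H" "x * y = (g * g') * (h * h')"
      by (auto simp: P_def mult_ac)
    then show "x * y \<in> vs.span P"
      using algebra_G algebra_H products_in_span[of "g * g'" "h * h'"]
      by (simp add: finite_algebra_def)
  qed
  then show ?thesis
    using products_in_span[OF algebra_G(2) algebra_H(2)] by (rule is_algebraic_if_finite_algebra)
qed

lemma is_algebraic_hom: "is_algebraic (hom a)"
  unfolding is_algebraic_def
  by (intro exI[of _ "[:- a, 1:]"]) (simp add: map_poly_pCons hom_uminus)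

lemma is_algebraic_uminus: "is_algebraic u \<Longrightarrow> is_algebraic (- u)"
  using is_algebraic_mult[OF is_algebraic_hom[of "- 1"]] by (simp add: hom_uminus)

lemma is_algebraic_prod_mset:
  "(\<And>u. u \<in># M \<Longrightarrow> is_algebraic u) \<Longrightarrow> is_algebraic (prod_mset M)"
proof (induction M)
  case empty
  then show ?case using is_algebraic_hom[of 1] by simp
qed (auto intro: is_algebraic_mult)

lemma is_algebraic_nonzero_relation:
  assumes "is_algebraic u" "u \<noteq> 0"
  obtains c q where "c \<noteq> 0" "u * poly (map_poly hom q) u = hom c"
proof -
  have "\<exists>c q. c \<noteq> 0 \<and> u * poly (map_poly hom q) u = hom c"
    if "p \<noteq> 0" "poly (map_poly hom p) u = 0" for p
    using that
  proof (induction p)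
    case (pCons a p)
    show ?case
    proof (cases "a = 0")
      case True
      then show ?thesis
        using pCons assms(2) by (auto simp: map_poly_pCons)
    next
      case False
      then show ?thesis
        using pCons.prems
        by (intro exI[of _ "- a"] exI[of _ p])
           (auto simp: map_poly_pCons hom_uminus eq_neg_iff_add_eq_0 add.commute)
    qed
  qed simp
  then show ?thesis
    using assms(1) that unfolding is_algebraic_def by blast
qed

lemma finite_algebra_inverse:
  assumes "finite_algebra G" "u \<in> vs.span G"
  shows "inverse u \<in> vs.span G"
proof (cases "u = 0")
  case True
  then show ?thesis by (simp add: vs.span_zero)
next
  case False
  obtain c q where relation: "c \<noteq> 0" "u * poly (map_poly hom q) u = hom c"
    using is_algebraic_nonzero_relation[OF is_algebraic_if_finite_algebra[OF assms] False] .
  then have "u * (hom (inverse c) * poly (map_poly hom q) u) = 1"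
    by (simp add: mult.left_commute[of u] hom_inverse hom_eq_0_iff)
  then have "inverse u = hom (inverse c) * poly (map_poly hom q) u"
    by (rule inverse_unique)
  also have "\<dots> \<in> vs.span G"
    by (intro vs.span_scale finite_algebra_poly assms)
  finally show ?thesis .
qed

end

text \<open>Up to sign, the constant coefficient is the leading coefficient times a product of roots.\<close>

lemma is_algebraic_coeff_0_of_factor:
  fixes emb :: "'k::field \<Rightarrow> 'l::alg_closed_field"
  assumes "field_embedding emb" "N * M = map_poly emb Q" "Q \<noteq> 0" "lead_coeff N = 1"
  shows "field_embedding.is_algebraic emb (coeff M 0)"
proof -
  interpret field_embedding emb by fact
  have degree_Q: "degree (map_poly emb Q) = degree Q"
    using assms(3) by (intro degree_map_poly) (simp add: hom_eq_0_iff)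
  have "M \<noteq> 0"
    using assms(2,3) degree_Q by (auto simp: map_poly_eq_0_iff hom_eq_0_iff)
  then obtain A where factorization: "M = smult (lead_coeff M) (\<Prod>x\<in>#A. [:-x, 1:])"
    using alg_closed_imp_factorization by blast
  have "lead_coeff M = emb (lead_coeff Q)"
    using arg_cong[OF assms(2), of lead_coeff] degree_Q
    by (simp add: lead_coeff_mult assms(4) coeff_map_poly)
  then have "coeff M 0 = emb (lead_coeff Q) * (\<Prod>x\<in>#A. - x)"
    by (subst factorization)
       (simp add: poly_0_coeff_0[symmetric] poly_prod_mset image_mset.compositionality o_def)
  moreover have "is_algebraic x" if "x \<in># A" for x
  proof -
    have "poly M x = 0"
      by (subst factorization) (use that in \<open>auto simp: poly_prod_mset prod_mset_zero_iff\<close>)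
    then have "poly (map_poly emb Q) x = 0"
      by (simp add: assms(2)[symmetric])
    then show ?thesis
      using assms(3) unfolding is_algebraic_def by blast
  qed
  ultimately show ?thesis
    by (auto intro!: is_algebraic_mult is_algebraic_hom is_algebraic_prod_mset is_algebraic_uminus)
qed


subsection \<open>Spans over the field of rational functions\<close>

interpretation rf: field_embedding "ratfun_embed :: 'a::idom poly fract \<Rightarrow> 'a fps fract"
  by unfold_locales (rule ratfun_embed_add ratfun_embed_mult ratfun_embed_1)+

interpretation to_fract: comm_ring_hom "to_fract :: 'a::idom \<Rightarrow> 'a fract"
  by unfold_locales simp_all

interpretation fps_of_poly: comm_ring_hom "fps_of_poly :: 'a::comm_ring_1 poly \<Rightarrow> 'a fps"
  by unfold_locales (simp_all add: fps_of_poly_add fps_of_poly_mult)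

definition rat_span :: "'a::idom fps set \<Rightarrow> 'a fps set" where
  "rat_span G = {g. to_fract g \<in> ratfun.span (to_fract ` G)}"

lemma rat_span_iff: "f \<in> rat_span G \<longleftrightarrow> to_fract f \<in> rf.vs.span (to_fract ` G)"
  by (simp add: rat_span_def ratfun_scale_def[abs_def])

lemma rat_span_base: "g \<in> G \<Longrightarrow> g \<in> rat_span G"
  by (auto simp: rat_span_def intro: ratfun.span_base)

lemma rat_span_0: "0 \<in> rat_span G"
  by (simp add: rat_span_def ratfun.span_zero)

lemma rat_span_add: "f \<in> rat_span G \<Longrightarrow> g \<in> rat_span G \<Longrightarrow> f + g \<in> rat_span G"
  by (simp add: rat_span_def ratfun.span_add)

lemma rat_span_diff: "f \<in> rat_span G \<Longrightarrow> g \<in> rat_span G \<Longrightarrow> f - g \<in> rat_span G"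
  by (simp add: rat_span_def ratfun.span_diff)

lemma rat_span_uminus: "f \<in> rat_span G \<Longrightarrow> - f \<in> rat_span G"
  by (simp add: rat_span_def ratfun.span_neg)

lemma rat_span_sum: "(\<And>i. i \<in> I \<Longrightarrow> f i \<in> rat_span G) \<Longrightarrow> sum f I \<in> rat_span G"
  by (simp add: rat_span_def ratfun.span_sum)

lemma rat_span_mono: "G \<subseteq> H \<Longrightarrow> rat_span G \<subseteq> rat_span H"
  unfolding rat_span_def using ratfun.span_mono[of "to_fract ` G" "to_fract ` H"] by blast

lemma to_fract_fps_of_poly: "to_fract (fps_of_poly p) = ratfun_embed (to_fract p)"
  by (simp add: ratfun_embed_Fract to_fract_def)

lemma rat_span_poly_mult: "g \<in> rat_span G \<Longrightarrow> fps_of_poly p * g \<in> rat_span G"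
  using ratfun.span_scale[of "to_fract g" "to_fract ` G" "to_fract p"]
  by (simp add: rat_span_def ratfun_scale_def to_fract_fps_of_poly)

lemma rat_span_cancel_poly:
  assumes "q \<noteq> 0" "fps_of_poly q * g \<in> rat_span G"
  shows "g \<in> rat_span G"
proof -
  let ?scaled = "ratfun_scale (inverse (to_fract q)) (to_fract (fps_of_poly q * g))"
  have "?scaled \<in> ratfun.span (to_fract ` G)"
    using assms(2) by (intro ratfun.span_scale) (simp add: rat_span_def)
  also have "?scaled = to_fract g"
    using assms(1)
    by (simp add: ratfun_scale_def to_fract_fps_of_poly rf.hom_inverse rf.hom_eq_0_iff
        del: inverse_fract mult_fract)
  finally show ?thesis by (simp add: rat_span_def)
qed

lemma common_denominator:
  fixes c :: "'v \<Rightarrow> 'a::idom fract"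
  assumes "finite S"
  obtains d p where "d \<noteq> 0" "\<And>v. v \<in> S \<Longrightarrow> to_fract d * c v = to_fract (p v)"
proof -
  have "\<exists>a b. b \<noteq> 0 \<and> to_fract b * c v = to_fract a" for v
  proof (cases "c v")
    case (Fract a b)
    then have "to_fract b * c v = to_fract a"
      by (simp add: to_fract_def eq_fract)
    with Fract show ?thesis by blast
  qed
  then obtain a b where denominators: "\<And>v. b v \<noteq> 0" "\<And>v. to_fract (b v) * c v = to_fract (a v)"
    by metis
  have "to_fract (\<Prod>w\<in>S. b w) * c v = to_fract (a v * (\<Prod>w\<in>S - {v}. b w))" if "v \<in> S" for v
  proof -
    have "to_fract (\<Prod>w\<in>S. b w) * c v = (to_fract (b v) * c v) * to_fract (\<Prod>w\<in>S - {v}. b w)"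
      by (simp only: prod.remove[OF assms that] to_fract_mult mult_ac)
    then show ?thesis
      by (simp only: denominators(2) to_fract_mult)
  qed
  moreover have "(\<Prod>w\<in>S. b w) \<noteq> 0"
    using denominators(1) assms by simp
  ultimately show ?thesis
    using that[of "\<Prod>w\<in>S. b w" "\<lambda>v. a v * (\<Prod>w\<in>S - {v}. b w)"] by blast
qed

lemma rat_span_common_denominator:
  assumes "finite F" "finite G" "F \<subseteq> rat_span G"
  obtains q p where "q \<noteq> 0"
    "\<And>f. f \<in> F \<Longrightarrow> fps_of_poly q * f = (\<Sum>g\<in>G. fps_of_poly (p f g) * g)"
proof -
  have inj_to_fract: "inj_on to_fract G" by (auto simp: inj_on_def)
  have "\<exists>c. to_fract f = (\<Sum>g\<in>G. ratfun_embed (c g) * to_fract g)" if "f \<in> F" for f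
  proof -
    have "to_fract f \<in> ratfun.span (to_fract ` G)"
      using that assms(3) by (auto simp: rat_span_def)
    then obtain u where "to_fract f = (\<Sum>v\<in>to_fract ` G. ratfun_scale (u v) v)"
      using assms(2) by (auto simp: ratfun.span_finite)
    then have "to_fract f = (\<Sum>g\<in>G. ratfun_embed (u (to_fract g)) * to_fract g)"
      by (simp add: sum.reindex[OF inj_to_fract] ratfun_scale_def)
    then show ?thesis by (rule exI[of _ "\<lambda>g. u (to_fract g)"])
  qed
  then obtain c where combination:
      "\<And>f. f \<in> F \<Longrightarrow> to_fract f = (\<Sum>g\<in>G. ratfun_embed (c f g) * to_fract g)"
    by metis
  obtain q p where q_nonzero: "q \<noteq> 0"
    and cleared: "\<And>v. v \<in> F \<times> G \<Longrightarrow> to_fract q * c (fst v) (snd v) = to_fract (p v)"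
    using common_denominator[of "F \<times> G" "\<lambda>v. c (fst v) (snd v)"] assms(1,2) by auto
  have "fps_of_poly q * f = (\<Sum>g\<in>G. fps_of_poly (p (f, g)) * g)" if f: "f \<in> F" for f
  proof -
    have "ratfun_embed (to_fract q) * (ratfun_embed (c f g) * to_fract g) =
        to_fract (fps_of_poly (p (f, g)) * g)" if "g \<in> G" for g
    proof -
      have "ratfun_embed (to_fract q * c f g) = ratfun_embed (to_fract (p (f, g)))"
        using cleared[of "(f, g)"] f that by simp
      then show ?thesis
        by (simp add: rf.hom_mult to_fract_fps_of_poly mult.assoc[symmetric])
    qed
    then have "to_fract (fps_of_poly q * f) = to_fract (\<Sum>g\<in>G. fps_of_poly (p (f, g)) * g)"
      unfolding to_fract_mult to_fract_fps_of_poly combination[OF f] sum_distrib_left to_fract_sum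
      by (intro sum.cong) (simp_all add: to_fract_fps_of_poly)
    then show ?thesis
      by (simp only: to_fract_eq_iff)
  qed
  with q_nonzero show ?thesis
    using that[of q "\<lambda>f g. p (f, g)"] by blast
qed

definition ratfun_derivation :: "('a::idom fps \<Rightarrow> 'a fps) \<Rightarrow> bool" where
  "ratfun_derivation \<delta> \<longleftrightarrow> derivation \<delta> \<and> (\<forall>p. \<exists>p'. \<delta> (fps_of_poly p) = fps_of_poly p')"

lemma ratfun_derivationE:
  assumes "ratfun_derivation \<delta>"
  obtains D where "derivation \<delta>" "\<And>p. \<delta> (fps_of_poly p) = fps_of_poly (D p)"
  using assms unfolding ratfun_derivation_def by metis

lemma rat_span_derivation:
  assumes ratfun: "ratfun_derivation \<delta>" and "finite G" "\<And>g. g \<in> G \<Longrightarrow> \<delta> g \<in> rat_span G"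
    and f_in_span: "f \<in> rat_span G"
  shows "\<delta> f \<in> rat_span G"
proof -
  obtain D where "derivation \<delta>" and deriv_poly: "\<And>p. \<delta> (fps_of_poly p) = fps_of_poly (D p)"
    using ratfun by (rule ratfun_derivationE) blast
  interpret derivation \<delta> by fact
  obtain q p where relation: "q \<noteq> 0" "fps_of_poly q * f = (\<Sum>h\<in>G. fps_of_poly (p f h) * h)"
    using rat_span_common_denominator[of "{f}" G] f_in_span assms(2) by auto
  have "fps_of_poly q * \<delta> f = \<delta> (fps_of_poly q * f) - fps_of_poly (D q) * f"
    by (simp add: mult deriv_poly)
  also have "\<delta> (fps_of_poly q * f) =
      (\<Sum>h\<in>G. fps_of_poly (D (p f h)) * h + fps_of_poly (p f h) * \<delta> h)"
    unfolding relation by (simp add: sum mult deriv_poly)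
  also have "\<dots> - fps_of_poly (D q) * f \<in> rat_span G"
    by (intro rat_span_diff rat_span_sum rat_span_add rat_span_poly_mult f_in_span assms
        rat_span_base)
  finally show ?thesis
    by (rule rat_span_cancel_poly[OF relation(1)])
qed


subsection \<open>Finite algebras of series\<close>

definition rat_algebra :: "'a::idom fps set \<Rightarrow> bool" where
  "rat_algebra G \<longleftrightarrow> rf.finite_algebra (to_fract ` G)"

lemma rat_algebra_finite: "rat_algebra G \<Longrightarrow> finite G"
  using finite_imageD[of to_fract G]
  by (auto simp: rat_algebra_def rf.finite_algebra_def inj_on_def)

lemma rat_algebra_1: "rat_algebra G \<Longrightarrow> 1 \<in> rat_span G"
  by (simp add: rat_algebra_def rf.finite_algebra_def rat_span_iff)

lemma rat_algebra_mult:
  "rat_algebra G \<Longrightarrow> f \<in> rat_span G \<Longrightarrow> g \<in> rat_span G \<Longrightarrow> f * g \<in> rat_span G"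
  using rf.finite_algebra_mult[of "to_fract ` G" "to_fract f" "to_fract g"]
  by (simp add: rat_algebra_def rat_span_iff)

lemma rat_algebra_power: "rat_algebra G \<Longrightarrow> f \<in> rat_span G \<Longrightarrow> f ^ n \<in> rat_span G"
  by (induction n) (simp_all add: rat_algebra_1 rat_algebra_mult)

lemma rat_algebra_poly:
  assumes "rat_algebra G" "f \<in> rat_span G" "\<And>i. \<exists>r. coeff p i = fps_of_poly r"
  shows "poly p f \<in> rat_span G"
  unfolding poly_altdef
proof (rule rat_span_sum)
  fix i
  obtain r where "coeff p i = fps_of_poly r" using assms(3) by blast
  then show "coeff p i * f ^ i \<in> rat_span G"
    by (simp add: rat_span_poly_mult rat_algebra_power assms)
qed

lemma rat_algebra_cancel:
  assumes algebra: "rat_algebra G" "h \<in> rat_span G" and "h \<noteq> 0"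
    and product_in_span: "h * f \<in> rat_span G"
  shows "f \<in> rat_span G"
proof -
  have "inverse (to_fract h) \<in> rf.vs.span (to_fract ` G)"
    using algebra
    by (intro rf.finite_algebra_inverse) (simp_all add: rat_algebra_def rat_span_iff)
  then have "inverse (to_fract h) * to_fract (h * f) \<in> rf.vs.span (to_fract ` G)"
    using algebra(1) product_in_span
    by (intro rf.finite_algebra_mult) (simp_all add: rat_algebra_def rat_span_iff)
  also have "inverse (to_fract h) * to_fract (h * f) = to_fract f"
    using \<open>h \<noteq> 0\<close> by (simp del: inverse_fract mult_fract)
  finally show ?thesis by (simp add: rat_span_iff)
qed

lemma rat_algebra_singleton_1: "rat_algebra {1}"
  by (simp add: rat_algebra_def rf.finite_algebra_def rf.vs.span_base)

lemma is_algebraic_imp_rat_algebra: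
  assumes "rf.is_algebraic (to_fract f)"
  obtains G where "rat_algebra G" "f \<in> rat_span G"
proof -
  obtain n where powers: "rf.finite_algebra ((\<lambda>i. to_fract f ^ i) ` {..<n})"
      "to_fract f \<in> rf.vs.span ((\<lambda>i. to_fract f ^ i) ` {..<n})"
    using assms by (rule rf.is_algebraic_imp_finite_algebra)
  have "(\<lambda>i. to_fract f ^ i) ` {..<n} = to_fract ` (\<lambda>i. f ^ i) ` {..<n}"
    by (simp add: image_image to_fract.hom_power)
  then show ?thesis
    using powers that[of "(\<lambda>i. f ^ i) ` {..<n}"] by (simp add: rat_algebra_def rat_span_iff)
qed

lemma is_algebraic_imp_poly_relation:
  assumes "rf.is_algebraic (to_fract f)"
  obtains p where "p \<noteq> 0" "poly (map_poly fps_of_poly p) f = 0"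
proof -
  obtain p where root: "p \<noteq> 0" "poly (map_poly ratfun_embed p) (to_fract f) = 0"
    using assms unfolding rf.is_algebraic_def by blast
  obtain d r where d_nonzero: "d \<noteq> 0"
    and cleared: "\<And>i. i \<in> {..degree p} \<Longrightarrow> to_fract d * coeff p i = to_fract (r i)"
    by (rule common_denominator[of "{..degree p}" "coeff p"]) auto
  define q where "q = (\<Sum>i\<le>degree p. monom (r i) i)"
  have coeff_q: "to_fract (coeff q i) = to_fract d * coeff p i" for i
    using cleared[of i] by (simp add: q_def coeff_sum coeff_eq_0)
  have "q \<noteq> 0"
    using root(1) d_nonzero coeff_q[of "degree p"] by auto
  have "to_fract (poly (map_poly fps_of_poly q) f) =
      poly (map_poly to_fract (map_poly fps_of_poly q)) (to_fract f)"
    by (rule to_fract.hom_poly)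
  also have "map_poly to_fract (map_poly fps_of_poly q) =
      smult (ratfun_embed (to_fract d)) (map_poly ratfun_embed p)"
    by (rule poly_eqI) (simp add: coeff_map_poly to_fract_fps_of_poly coeff_q rf.hom_mult)
  finally have "poly (map_poly fps_of_poly q) f = 0"
    using root(2) by simp
  with \<open>q \<noteq> 0\<close> show ?thesis by (rule that)
qed

text \<open>Differentiate a relation of least degree; the factor of \<open>\<delta> f\<close> does not vanish.\<close>

lemma rat_algebra_derivation:
  fixes f :: "'a::{idom,ring_char_0} fps"
  assumes algebra: "rat_algebra G" "f \<in> rat_span G" and ratfun: "ratfun_derivation \<delta>"
  shows "\<delta> f \<in> rat_span G"
proof -
  obtain D where "derivation \<delta>" and deriv_poly: "\<And>p. \<delta> (fps_of_poly p) = fps_of_poly (D p)"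
    using ratfun by (rule ratfun_derivationE) blast
  interpret derivation \<delta> by fact
  define R where "R p \<longleftrightarrow> p \<noteq> 0 \<and> poly (map_poly fps_of_poly p) f = 0" for p
  have "rf.is_algebraic (to_fract f)"
    using algebra by (intro rf.is_algebraic_if_finite_algebra[of "to_fract ` G"])
      (simp_all add: rat_algebra_def rat_span_iff)
  then have "\<exists>p. R p"
    unfolding R_def by (metis is_algebraic_imp_poly_relation)
  then obtain p where "R p" and least: "\<And>q. R q \<Longrightarrow> degree p \<le> degree q"
    using ex_has_least_nat[of R _ degree] by blast
  let ?p = "map_poly fps_of_poly p"
  have relation: "p \<noteq> 0" "poly ?p f = 0"
    using \<open>R p\<close> by (simp_all add: R_def)
  have "degree p \<noteq> 0"
  proof
    assume "degree p = 0"
    then obtain c where "p = [:c:]" by (rule degree_eq_zeroE)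
    then show False using relation fps_of_poly_nonzero[of c] by (simp add: map_poly_pCons)
  qed
  have coeff_pderiv_p: "fps_of_poly (coeff (pderiv p) i) = coeff (pderiv ?p) i" for i
    by (simp add: coeff_pderiv coeff_map_poly fps_of_poly.hom_mult fps_of_poly.hom_add
        fps_of_poly.hom_of_nat)
  then have pderiv_p: "pderiv ?p = map_poly fps_of_poly (pderiv p)"
    by (intro poly_eqI) (simp add: coeff_map_poly)
  have nonzero: "poly (pderiv ?p) f \<noteq> 0"
    using least[of "pderiv p"] \<open>degree p \<noteq> 0\<close>
    by (auto simp: R_def pderiv_p pderiv_eq_0_iff degree_pderiv)
  have "poly (pderiv ?p) f * \<delta> f = - poly (map_poly \<delta> ?p) f"
    using derivation_poly[OF \<open>derivation \<delta>\<close>, of ?p f] relation(2)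
    by (simp add: eq_neg_iff_add_eq_0 add.commute)
  also have "\<dots> \<in> rat_span G"
    by (intro rat_span_uminus rat_algebra_poly algebra) (auto simp: coeff_map_poly deriv_poly)
  finally show ?thesis
    by (rule rat_algebra_cancel[OF algebra(1) _ nonzero, rotated])
       (intro rat_algebra_poly algebra, metis coeff_pderiv_p)
qed


subsection \<open>D-finite series\<close>

definition deriv_closed :: "('a::idom fps \<Rightarrow> 'a fps) set \<Rightarrow> 'a fps set \<Rightarrow> bool" where
  "deriv_closed \<Delta> G \<longleftrightarrow> finite G \<and> (\<forall>\<delta>\<in>\<Delta>. \<forall>g\<in>G. \<delta> g \<in> rat_span G)"

lemma deriv_closed_Un:
  assumes "deriv_closed \<Delta> G" "deriv_closed \<Delta> H"
  shows "deriv_closed \<Delta> (G \<union> H)"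
  using assms rat_span_mono[of G "G \<union> H"] rat_span_mono[of H "G \<union> H"]
  unfolding deriv_closed_def by blast

lemma D_finiteI:
  assumes ratfun: "\<And>\<delta>. \<delta> \<in> \<Delta> \<Longrightarrow> ratfun_derivation \<delta>" and closed: "deriv_closed \<Delta> G" "f \<in> rat_span G"
  shows "D_finite \<Delta> f"
proof -
  let ?V = "to_fract ` iterated_derivs \<Delta> f"
  have "g \<in> rat_span G" if "g \<in> iterated_derivs \<Delta> f" for g
    using that
  proof induction
    case base
    show ?case by (rule closed(2))
  next
    case (step g \<delta>)
    then show ?case
      using closed(1) by (auto simp: deriv_closed_def intro: rat_span_derivation ratfun)
  qed
  then have derivs_in_span: "?V \<subseteq> ratfun.span (to_fract ` G)"
    by (auto simp: rat_span_def)
  obtain B where basis: "B \<subseteq> ?V" "ratfun.independent B" "?V \<subseteq> ratfun.span B"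
    by (rule ratfun.maximal_independent_subset)
  have "finite B"
    using ratfun.independent_span_bound[of "to_fract ` G" B] basis derivs_in_span closed(1)
    by (auto simp: deriv_closed_def)
  moreover have "ratfun.span ?V = ratfun.span B"
    using basis(1,3)
    by (meson ratfun.span_mono ratfun.span_minimal ratfun.subspace_span subset_antisym)
  ultimately show ?thesis
    unfolding D_finite_def to_fract_def by blast
qed

lemma D_finiteE:
  assumes "D_finite \<Delta> f"
  obtains G where "deriv_closed \<Delta> G" "f \<in> G"
proof -
  let ?V = "to_fract ` iterated_derivs \<Delta> f"
  obtain T where generators: "finite T" "ratfun.span ?V = ratfun.span T"
    using assms unfolding D_finite_def to_fract_def by blast
  obtain B where basis: "B \<subseteq> ?V" "ratfun.independent B" "?V \<subseteq> ratfun.span B"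
    by (rule ratfun.maximal_independent_subset)
  then have "B \<subseteq> ratfun.span T"
    using generators(2) ratfun.span_superset by blast
  then have "finite B"
    using ratfun.independent_span_bound[OF generators(1) basis(2)] by simp
  then obtain G where preimage: "G \<subseteq> iterated_derivs \<Delta> f" "finite G" "B = to_fract ` G"
    using finite_subset_image[OF _ basis(1)] by blast
  have derivs_in_span: "g \<in> rat_span (insert f G)" if "g \<in> iterated_derivs \<Delta> f" for g
    using that basis(3) preimage(3) rat_span_mono[of G "insert f G"] by (auto simp: rat_span_def)
  have "insert f G \<subseteq> iterated_derivs \<Delta> f"
    using preimage(1) by (simp add: iterated_derivs.base)
  then have "\<delta> g \<in> rat_span (insert f G)" if "\<delta> \<in> \<Delta>" "g \<in> insert f G" for \<delta> g
    using that derivs_in_span[OF iterated_derivs.step[of g \<Delta> f \<delta>]] by auto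
  then have "deriv_closed \<Delta> (insert f G)"
    using preimage(2) by (simp add: deriv_closed_def)
  then show ?thesis using that by blast
qed

lemma D_finite_common_deriv_closed:
  assumes "finite F" "\<And>f. f \<in> F \<Longrightarrow> D_finite \<Delta> f"
  obtains G where "deriv_closed \<Delta> G" "F \<subseteq> G"
proof -
  have "\<exists>G. deriv_closed \<Delta> G \<and> F \<subseteq> G"
    using assms
  proof (induction F)
    case empty
    have "deriv_closed \<Delta> {}" by (simp add: deriv_closed_def)
    then show ?case by blast
  next
    case (insert f F)
    then obtain G where closed_G: "deriv_closed \<Delta> G" "F \<subseteq> G" by auto
    obtain H where closed_H: "deriv_closed \<Delta> H" "f \<in> H"
      using insert.prems by (auto elim: D_finiteE)
    show ?case
      using deriv_closed_Un[OF closed_G(1) closed_H(1)] closed_G(2) closed_H(2) by blast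
  qed
  then show ?thesis using that by blast
qed

lemma D_finite_uminus:
  assumes "\<And>\<delta>. \<delta> \<in> \<Delta> \<Longrightarrow> ratfun_derivation \<delta>" "D_finite \<Delta> f"
  shows "D_finite \<Delta> (- f)"
proof -
  obtain G where closed: "deriv_closed \<Delta> G" "f \<in> G"
    using assms(2) by (rule D_finiteE)
  show ?thesis
    using assms(1) closed(1)
    by (rule D_finiteI) (use closed(2) in \<open>auto intro: rat_span_uminus rat_span_base\<close>)
qed

lemma D_finite_diff:
  assumes "\<And>\<delta>. \<delta> \<in> \<Delta> \<Longrightarrow> ratfun_derivation \<delta>" "D_finite \<Delta> f" "D_finite \<Delta> g"
  shows "D_finite \<Delta> (f - g)"
proof -
  obtain G where closed: "deriv_closed \<Delta> G" "{f, g} \<subseteq> G"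
    by (rule D_finite_common_deriv_closed[of "{f, g}" \<Delta>]) (use assms(2,3) in auto)
  show ?thesis
    using assms(1) closed(1)
    by (rule D_finiteI) (use closed(2) in \<open>auto intro: rat_span_diff rat_span_base\<close>)
qed


subsection \<open>Laurent polynomials\<close>

lemma poly_mapping_additive_induct [case_names zero single add]:
  fixes p :: "'k \<Rightarrow>\<^sub>0 'a::comm_monoid_add"
  assumes "P 0" "\<And>k c. P (Poly_Mapping.single k c)" "\<And>p q. P p \<Longrightarrow> P q \<Longrightarrow> P (p + q)"
  shows "P p"
proof (induction p rule: update_induct)
  case (update p k c)
  have "Poly_Mapping.update k c p = p + Poly_Mapping.single k c"
    using update(1)
    by (intro poly_mapping_eqI) (auto simp: lookup_update lookup_add lookup_single in_keys_iff)
  then show ?case using update assms by simp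
qed (rule assms)

lemma lookup_laurent_mult:
  fixes p q :: "'a::comm_ring_1 laurent"
  assumes "finite A" "\<And>i. i \<notin> A \<Longrightarrow> Poly_Mapping.lookup p i = 0 \<or> Poly_Mapping.lookup q (k - i) = 0"
  shows "Poly_Mapping.lookup (p * q) k =
      (\<Sum>i\<in>A. Poly_Mapping.lookup p i * Poly_Mapping.lookup q (k - i))"
proof -
  have "k = i + j \<longleftrightarrow> j = k - i" for i j by auto
  then have "Poly_Mapping.lookup (p * q) k =
      (\<Sum>i. Poly_Mapping.lookup p i * Poly_Mapping.lookup q (k - i))"
    by (simp add: lookup_mult)
  also have "\<dots> = (\<Sum>i\<in>A. Poly_Mapping.lookup p i * Poly_Mapping.lookup q (k - i))"
    by (rule Sum_any.expand_superset[OF assms(1)]) (use assms(2) in force)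
  finally show ?thesis .
qed

lemma lookup_single_mult:
  fixes p :: "'a::comm_ring_1 laurent"
  shows "Poly_Mapping.lookup (Poly_Mapping.single v c * p) k = c * Poly_Mapping.lookup p (k - v)"
  by (subst lookup_laurent_mult[of "{v}"]) (auto simp: lookup_single when_def)

lemma lookup_laurent_deriv:
  "Poly_Mapping.lookup (laurent_deriv p) k = of_int (k + 1) * Poly_Mapping.lookup p (k + 1)"
proof -
  have "Poly_Mapping.lookup (laurent_deriv p) k =
      (\<Sum>i\<in>Poly_Mapping.keys p. if i = k + 1 then of_int i * Poly_Mapping.lookup p i else 0)"
    unfolding laurent_deriv_def lookup_sum
    by (intro sum.cong) (auto simp: lookup_single when_def)
  also have "\<dots> = of_int (k + 1) * Poly_Mapping.lookup p (k + 1)"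
    by (simp add: in_keys_iff del: of_int_add)
  finally show ?thesis .
qed

lemma laurent_deriv_single:
  "laurent_deriv (Poly_Mapping.single k c) = Poly_Mapping.single (k - 1) (of_int k * c)"
  by (rule poly_mapping_eqI) (auto simp: lookup_laurent_deriv lookup_single when_def)

lemma derivation_laurentI:
  fixes \<delta> :: "'a::comm_ring_1 laurent \<Rightarrow> 'a laurent"
  assumes add: "\<And>p q. \<delta> (p + q) = \<delta> p + \<delta> q"
    and single: "\<And>i c j d. \<delta> (Poly_Mapping.single i c * Poly_Mapping.single j d) =
      \<delta> (Poly_Mapping.single i c) * Poly_Mapping.single j d +
      Poly_Mapping.single i c * \<delta> (Poly_Mapping.single j d)"
  shows "derivation \<delta>"
proof (rule derivation.intro[OF add])
  fix p q
  have zero: "\<delta> 0 = 0" using add[of 0 0] by simp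
  have single_mult: "\<delta> (Poly_Mapping.single i c * q) =
      \<delta> (Poly_Mapping.single i c) * q + Poly_Mapping.single i c * \<delta> q" for i c
    by (induction q rule: poly_mapping_additive_induct)
       (simp_all add: zero single add distrib_left)
  show "\<delta> (p * q) = \<delta> p * q + p * \<delta> q"
    by (induction p rule: poly_mapping_additive_induct)
       (simp_all add: zero single_mult add distrib_right)
qed

lemma derivation_laurent_deriv: "derivation laurent_deriv"
proof (rule derivation_laurentI)
  show "laurent_deriv (p + q) = laurent_deriv p + laurent_deriv q" for p q :: "'a laurent"
    by (rule poly_mapping_eqI) (simp add: lookup_laurent_deriv lookup_add algebra_simps)
  show "laurent_deriv (Poly_Mapping.single i c * Poly_Mapping.single j d) =
      laurent_deriv (Poly_Mapping.single i c) * Poly_Mapping.single j d +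
      Poly_Mapping.single i c * laurent_deriv (Poly_Mapping.single j d)"
    for i j and c d :: 'a
    by (simp add: mult_single laurent_deriv_single single_add[symmetric] algebra_simps)
qed

lemma lookup_map_zero_preserving:
  "f 0 = 0 \<Longrightarrow> Poly_Mapping.lookup (Poly_Mapping.map f p) k = f (Poly_Mapping.lookup p k)"
  by (simp add: Poly_Mapping.map.rep_eq when_def)

lemma derivation_map:
  fixes \<delta> :: "'a::comm_ring_1 \<Rightarrow> 'a"
  assumes "derivation \<delta>"
  shows "derivation (Poly_Mapping.map \<delta> :: 'a laurent \<Rightarrow> 'a laurent)"
proof -
  interpret derivation \<delta> by fact
  have map_single: "Poly_Mapping.map \<delta> (Poly_Mapping.single i c) = Poly_Mapping.single i (\<delta> c)"
    for i :: int and c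
    by (rule poly_mapping_eqI) (simp add: lookup_map_zero_preserving lookup_single when_def)
  show ?thesis
  proof (rule derivation_laurentI)
    show "Poly_Mapping.map \<delta> (p + q) = Poly_Mapping.map \<delta> p + Poly_Mapping.map \<delta> q"
      for p q :: "'a laurent"
      by (rule poly_mapping_eqI) (simp add: lookup_map_zero_preserving lookup_add add)
    show "Poly_Mapping.map \<delta> (Poly_Mapping.single i c * Poly_Mapping.single j d) =
        Poly_Mapping.map \<delta> (Poly_Mapping.single i c) * Poly_Mapping.single j d +
        Poly_Mapping.single i c * Poly_Mapping.map \<delta> (Poly_Mapping.single j d)"
      for i j :: int and c d
      by (simp add: mult_single map_single single_add[symmetric] mult)
  qed
qed


subsection \<open>Coefficientwise maps on power series\<close>

lemma fps_map_nth [simp]: "fps_nth (fps_map h f) n = h (fps_nth f n)"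
  by (simp add: fps_map_def)

lemma derivation_fps_map:
  assumes "derivation \<delta>"
  shows "derivation (fps_map \<delta>)"
proof -
  interpret derivation \<delta> by fact
  show ?thesis
    by unfold_locales (simp_all add: fps_eq_iff fps_mult_nth add mult sum sum.distrib)
qed

lemma fps_map_fps_deriv: "derivation \<delta> \<Longrightarrow> fps_map \<delta> (fps_deriv f) = fps_deriv (fps_map \<delta> f)"
  by (simp add: fps_eq_iff derivation.of_nat_mult del: of_nat_Suc)

lemma derivation_fps_deriv: "derivation fps_deriv"
  by unfold_locales (simp_all add: mult_ac)

definition partial_derivation :: "('a::idom fps \<Rightarrow> 'a fps) \<Rightarrow> bool" where
  "partial_derivation \<delta> \<longleftrightarrow> \<delta> = fps_deriv \<or> (\<exists>\<epsilon>. derivation \<epsilon> \<and> \<delta> = fps_map \<epsilon>)"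

lemma ratfun_derivation_if_partial:
  assumes "partial_derivation \<delta>"
  shows "ratfun_derivation \<delta>"
  using assms unfolding partial_derivation_def
proof
  assume "\<exists>\<epsilon>. derivation \<epsilon> \<and> \<delta> = fps_map \<epsilon>"
  then obtain \<epsilon> where coefficientwise: "derivation \<epsilon>" "\<delta> = fps_map \<epsilon>" by blast
  have "fps_map \<epsilon> (fps_of_poly p) = fps_of_poly (map_poly \<epsilon> p)" for p
    by (simp add: fps_eq_iff coeff_map_poly derivation.zero[OF coefficientwise(1)])
  then show ?thesis
    using coefficientwise derivation_fps_map by (auto simp: ratfun_derivation_def)
next
  assume "\<delta> = fps_deriv"
  then show ?thesis
    unfolding ratfun_derivation_def by (metis derivation_fps_deriv fps_of_poly_pderiv)
qed

lemma derivation_if_partial: "partial_derivation \<delta> \<Longrightarrow> derivation \<delta>"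
  using ratfun_derivation_if_partial[of \<delta>] by (simp add: ratfun_derivation_def)

lemma D_finite_if_in_deriv_closed:
  assumes "\<And>\<delta>. \<delta> \<in> \<Delta> \<Longrightarrow> partial_derivation \<delta>" "deriv_closed \<Delta> G" "f \<in> G"
  shows "D_finite \<Delta> f"
  using ratfun_derivation_if_partial[OF assms(1)] assms(2) rat_span_base[OF assms(3)]
  by (rule D_finiteI)

lemma comm_ring_hom_fps_map:
  assumes "comm_ring_hom h"
  shows "comm_ring_hom (fps_map h)"
proof -
  interpret comm_ring_hom h by fact
  show ?thesis
    by unfold_locales (simp_all add: fps_eq_iff fps_mult_nth hom_add hom_mult hom_sum fps_one_def)
qed

lemma fps_map_hom_fps_deriv:
  assumes "comm_ring_hom h"
  shows "fps_map h (fps_deriv f) = fps_deriv (fps_map h f)"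
proof -
  interpret comm_ring_hom h by fact
  show ?thesis by (simp add: fps_eq_iff hom_mult hom_of_nat del: of_nat_Suc)
qed

lemma comm_ring_hom_laurent_const: "comm_ring_hom laurent_const"
  by unfold_locales (simp_all add: laurent_const_def single_add mult_single)

interpretation laurent_const: comm_ring_hom "laurent_const :: 'a::comm_ring_1 \<Rightarrow> 'a laurent"
  by (rule comm_ring_hom_laurent_const)

interpretation fps_lift: comm_ring_hom "fps_lift :: 'a::comm_ring_1 fps \<Rightarrow> 'a laurent fps"
  unfolding fps_lift_def by (rule comm_ring_hom_fps_map[OF comm_ring_hom_laurent_const])

lemma lookup_laurent_const: "Poly_Mapping.lookup (laurent_const c) k = (if k = 0 then c else 0)"
  by (simp add: laurent_const_def lookup_single when_def)

lemma fps_lift_nth [simp]: "fps_nth (fps_lift f) n = laurent_const (fps_nth f n)"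
  by (simp add: fps_lift_def)

lemma fps_lift_fps_deriv: "fps_lift (fps_deriv f) = fps_deriv (fps_lift f)"
  for f :: "'a::comm_ring_1 fps"
  unfolding fps_lift_def by (rule fps_map_hom_fps_deriv[OF comm_ring_hom_laurent_const])

lemma fps_lift_fps_of_poly: "fps_lift (fps_of_poly p) = fps_of_poly (map_poly laurent_const p)"
  for p :: "'a::comm_ring_1 poly"
  by (simp add: fps_eq_iff coeff_map_poly)

lemma fps_lift_fps_X: "fps_lift (fps_X :: 'a::comm_ring_1 fps) = fps_X"
  by (simp add: fps_eq_iff fps_X_def)

lemma laurent_const_eq_0_iff: "laurent_const c = 0 \<longleftrightarrow> c = 0"
  by (metis laurent_const_def lookup_single_eq single_zero lookup_zero)

lemma fps_map_laurent_deriv_lift: "fps_map laurent_deriv (fps_lift f) = 0"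
  by (simp add: fps_eq_iff laurent_const_def laurent_deriv_single)

lemma fps_map_map_lift:
  assumes "\<delta> 0 = 0"
  shows "fps_map (Poly_Mapping.map \<delta>) (fps_lift f) = fps_lift (fps_map \<delta> f)"
proof -
  have "Poly_Mapping.map \<delta> (laurent_const c) = laurent_const (\<delta> c)" for c
    by (rule poly_mapping_eqI) (simp add: assms lookup_map_zero_preserving lookup_laurent_const)
  then show ?thesis by (simp add: fps_eq_iff)
qed


subsection \<open>Coefficients of powers of \<open>x\<close>\<close>

definition xcoeff :: "int \<Rightarrow> 'a::zero laurent fps \<Rightarrow> 'a fps" where
  "xcoeff k = fps_map (\<lambda>p. Poly_Mapping.lookup p k)"

lemma xcoeff_nth [simp]: "fps_nth (xcoeff k f) n = Poly_Mapping.lookup (fps_nth f n) k"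
  by (simp add: xcoeff_def)

lemma laurent_fps_eqI: "(\<And>k. xcoeff k f = xcoeff k g) \<Longrightarrow> f = g"
  by (metis fps_ext poly_mapping_eqI xcoeff_nth)

lemma xcoeff_0 [simp]: "xcoeff k 0 = 0"
  and xcoeff_add: "xcoeff k (f + g) = xcoeff k f + xcoeff k g"
  by (simp_all add: fps_eq_iff lookup_add)

lemma xcoeff_diff: "xcoeff k (f - g :: 'a::comm_ring_1 laurent fps) = xcoeff k f - xcoeff k g"
  by (simp add: fps_eq_iff lookup_minus)

lemma xcoeff_sum: "xcoeff k (sum f A) = (\<Sum>i\<in>A. xcoeff k (f i))"
  by (induction A rule: infinite_finite_induct) (simp_all add: xcoeff_add)

lemma xcoeff_mult:
  fixes f g :: "'a::comm_ring_1 laurent fps"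
  assumes "finite A" "\<And>i. i \<notin> A \<Longrightarrow> xcoeff i f = 0 \<or> xcoeff (k - i) g = 0"
  shows "xcoeff k (f * g) = (\<Sum>i\<in>A. xcoeff i f * xcoeff (k - i) g)"
proof (rule fps_ext)
  fix n
  have "Poly_Mapping.lookup (fps_nth f m * fps_nth g (n - m)) k =
      (\<Sum>i\<in>A. fps_nth (xcoeff i f) m * fps_nth (xcoeff (k - i) g) (n - m))" for m
    by (subst lookup_laurent_mult[OF assms(1)]) (use assms(2) in \<open>auto simp: fps_eq_iff\<close>)
  then show "fps_nth (xcoeff k (f * g)) n = fps_nth (\<Sum>i\<in>A. xcoeff i f * xcoeff (k - i) g) n"
    by (simp add: fps_mult_nth fps_sum_nth lookup_sum sum.swap[of _ A])
qed

lemma xcoeff_lift: "xcoeff k (fps_lift f) = (if k = 0 then f else 0)"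
  by (simp add: fps_eq_iff lookup_laurent_const)

lemma xcoeff_1: "xcoeff k (1 :: 'a::comm_ring_1 laurent fps) = (if k = 0 then 1 else 0)"
  using xcoeff_lift[of k "1 :: 'a fps"] by simp

lemma xcoeff_lift_mult: "xcoeff k (fps_lift f * g :: 'a::comm_ring_1 laurent fps) = f * xcoeff k g"
  by (subst xcoeff_mult[of "{0}"]) (auto simp: xcoeff_lift)

lemma xcoeff_fps_deriv: "xcoeff k (fps_deriv f) = fps_deriv (xcoeff k f :: 'a::comm_ring_1 fps)"
proof -
  have "Poly_Mapping.lookup (of_nat n * p) k = of_nat n * Poly_Mapping.lookup p k"
    for n and p :: "'a laurent"
    by (induction n) (simp_all add: distrib_right lookup_add)
  then show ?thesis by (simp add: fps_eq_iff del: of_nat_Suc)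
qed

abbreviation x_deriv :: "'a::comm_ring_1 laurent fps \<Rightarrow> 'a laurent fps" where
  "x_deriv \<equiv> fps_map laurent_deriv"

lemma xcoeff_x_deriv: "xcoeff k (x_deriv f) = fps_const (of_int (k + 1)) * xcoeff (k + 1) f"
  by (simp add: fps_eq_iff lookup_laurent_deriv)

lemma xcoeff_fps_of_poly:
  "xcoeff k (fps_of_poly p) = fps_of_poly (map_poly (\<lambda>c. Poly_Mapping.lookup c k) p)"
  by (simp add: fps_eq_iff coeff_map_poly)

definition x_monom :: "int \<Rightarrow> 'a::comm_ring_1 laurent fps" where
  "x_monom v = fps_const (Poly_Mapping.single v 1)"

lemma xcoeff_x_monom: "xcoeff k (x_monom v) = (if k = v then 1 else 0)"
  by (auto simp: fps_eq_iff x_monom_def lookup_single when_def)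

lemma xcoeff_x_monom_mult: "xcoeff k (x_monom v * f) = xcoeff (k - v) f"
  by (subst xcoeff_mult[of "{v}"]) (auto simp: xcoeff_x_monom)


subsection \<open>Supports\<close>

definition supp_in :: "int set \<Rightarrow> 'a::zero laurent fps \<Rightarrow> bool" where
  "supp_in A f \<longleftrightarrow> (\<forall>n. Poly_Mapping.keys (fps_nth f n) \<subseteq> A)"

lemma supp_in_iff: "supp_in A f \<longleftrightarrow> (\<forall>k. k \<notin> A \<longrightarrow> xcoeff k f = 0)"
  unfolding supp_in_def fps_eq_iff by (auto simp: in_keys_iff subset_iff)

lemma supp_in_mono: "supp_in A f \<Longrightarrow> A \<subseteq> B \<Longrightarrow> supp_in B f"
  by (auto simp: supp_in_def)

lemma supp_in_add: "supp_in A f \<Longrightarrow> supp_in A g \<Longrightarrow> supp_in A (f + g)"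
  by (simp add: supp_in_iff xcoeff_add)

lemma supp_in_diff: "supp_in A f \<Longrightarrow> supp_in A g \<Longrightarrow> supp_in A (f - g :: 'a::comm_ring_1 laurent fps)"
  by (simp add: supp_in_iff xcoeff_diff)

lemma supp_in_lift: "0 \<in> A \<Longrightarrow> supp_in A (fps_lift f)"
  by (auto simp: supp_in_iff xcoeff_lift)

lemma supp_in_1: "0 \<in> A \<Longrightarrow> supp_in A (1 :: 'a::comm_ring_1 laurent fps)"
  by (auto simp: supp_in_iff xcoeff_1)

lemma supp_in_fps_deriv: "supp_in A f \<Longrightarrow> supp_in A (fps_deriv f :: 'a::comm_ring_1 laurent fps)"
  by (simp add: supp_in_iff xcoeff_fps_deriv)

lemma supp_in_mult:
  fixes f g :: "'a::comm_ring_1 laurent fps"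
  assumes "supp_in A f" "supp_in B g" "\<And>a b. a \<in> A \<Longrightarrow> b \<in> B \<Longrightarrow> a + b \<in> C"
  shows "supp_in C (f * g)"
  unfolding supp_in_iff
proof (intro allI impI)
  fix k assume "k \<notin> C"
  then have "xcoeff i f = 0 \<or> xcoeff (k - i) g = 0" for i
    using assms(1,2) assms(3)[of i "k - i"] by (auto simp: supp_in_iff)
  then show "xcoeff k (f * g) = 0"
    using xcoeff_mult[of "{}" f k g] by simp
qed

lemma supp_in_nonneg_mult:
  "supp_in {0..} f \<Longrightarrow> supp_in {0..} g \<Longrightarrow> supp_in {0..} (f * g :: 'a::comm_ring_1 laurent fps)"
  by (rule supp_in_mult) auto

lemma supp_in_nonpos_mult:
  "supp_in {..0} f \<Longrightarrow> supp_in {..0} g \<Longrightarrow> supp_in {..0} (f * g :: 'a::comm_ring_1 laurent fps)"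
  by (rule supp_in_mult) auto

lemma xcoeff_0_mult:
  fixes f g :: "'a::comm_ring_1 laurent fps"
  assumes "supp_in {0..} f \<and> supp_in {0..} g \<or> supp_in {..0} f \<and> supp_in {..0} g"
  shows "xcoeff 0 (f * g) = xcoeff 0 f * xcoeff 0 g"
proof -
  have "xcoeff i f = 0 \<or> xcoeff (0 - i) g = 0" if "i \<notin> {0}" for i
    using assms that by (cases "i > 0") (auto simp: supp_in_iff)
  then show ?thesis
    by (subst xcoeff_mult[of "{0}"]) auto
qed

lemma supp_in_singleton_0: "supp_in {0} f \<Longrightarrow> f = fps_lift (xcoeff 0 f)"
  by (rule laurent_fps_eqI) (auto simp: supp_in_iff xcoeff_lift)

definition fps_recip :: "'a::comm_ring_1 fps \<Rightarrow> 'a fps" where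
  "fps_recip f = fps_right_inverse f 1"

lemma fps_recip: "fps_nth f 0 = 1 \<Longrightarrow> f * fps_recip f = 1"
  unfolding fps_recip_def by (rule fps_right_inverse) simp

lemma fps_recip_nth_0 [simp]: "fps_nth (fps_recip f) 0 = 1"
  by (simp add: fps_recip_def)

lemma keys_mult_subset:
  fixes p q :: "'a::comm_ring_1 laurent"
  assumes "Poly_Mapping.keys p \<subseteq> A" "Poly_Mapping.keys q \<subseteq> B" "\<And>a b. a \<in> A \<Longrightarrow> b \<in> B \<Longrightarrow> a + b \<in> C"
  shows "Poly_Mapping.keys (p * q) \<subseteq> C"
  using keys_mult[of p q] assms by blast

lemma keys_sum_subset:
  "(\<And>i. i \<in> I \<Longrightarrow> Poly_Mapping.keys (f i) \<subseteq> C) \<Longrightarrow> Poly_Mapping.keys (sum f I) \<subseteq> C"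
  using keys_sum[of f I] by blast

lemma supp_in_fps_recip:
  fixes f :: "'a::comm_ring_1 laurent fps"
  assumes "supp_in A f" "0 \<in> A" "\<And>a b. a \<in> A \<Longrightarrow> b \<in> A \<Longrightarrow> a + b \<in> A"
  shows "supp_in A (fps_recip f)"
  unfolding supp_in_def
proof
  fix n
  show "Poly_Mapping.keys (fps_nth (fps_recip f) n) \<subseteq> A"
  proof (induction n rule: less_induct)
    case (less n)
    show ?case
    proof (cases n)
      case 0
      then show ?thesis using assms(2) by simp
    next
      case (Suc m)
      have "fps_nth (fps_recip f) n = - (\<Sum>i = 1..n. fps_nth f i * fps_nth (fps_recip f) (n - i))"
        by (simp add: fps_recip_def Suc)
      also have "Poly_Mapping.keys \<dots> \<subseteq> A"
        unfolding keys_minus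
      proof (intro keys_sum_subset keys_mult_subset[OF _ _ assms(3)])
        fix i assume "i \<in> {1..n}"
        then show "Poly_Mapping.keys (fps_nth (fps_recip f) (n - i)) \<subseteq> A"
          using Suc by (intro less.IH) auto
        show "Poly_Mapping.keys (fps_nth f i) \<subseteq> A"
          using assms(1) by (simp add: supp_in_def)
      qed
      finally show ?thesis .
    qed
  qed
qed


subsection \<open>Logarithms\<close>

definition is_log :: "'a::comm_ring_1 fps \<Rightarrow> 'a fps \<Rightarrow> bool" where
  "is_log f l \<longleftrightarrow> fps_nth f 0 = 1 \<and> fps_nth l 0 = 0 \<and> f * fps_deriv l = fps_deriv f"

lemma fps_deriv_inject:
  fixes f g :: "'a::{idom,ring_char_0} fps"
  assumes "fps_deriv f = fps_deriv g" "fps_nth f 0 = fps_nth g 0"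
  shows "f = g"
  using assms by (auto simp: fps_deriv_eq_iff)

lemma is_log_unique:
  fixes f :: "'a::{idom,ring_char_0} fps"
  assumes "is_log f l" "is_log f m"
  shows "l = m"
proof -
  have "f \<noteq> 0" using assms(1) by (auto simp: is_log_def)
  moreover have "f * fps_deriv l = f * fps_deriv m"
    using assms by (simp add: is_log_def)
  ultimately have "fps_deriv l = fps_deriv m" by simp
  then show ?thesis
    by (rule fps_deriv_inject) (use assms in \<open>simp add: is_log_def\<close>)
qed

lemma is_log_1: "is_log 1 0"
  by (simp add: is_log_def)

lemma is_log_mult:
  assumes "is_log f l" "is_log g m"
  shows "is_log (f * g) (l + m)"
proof -
  have "f * g * fps_deriv (l + m) = g * (f * fps_deriv l) + f * (g * fps_deriv m)"
    by (simp add: algebra_simps)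
  then show ?thesis
    using assms by (simp add: is_log_def mult.commute add.commute)
qed

lemma is_log_lift: "is_log f l \<Longrightarrow> is_log (fps_lift f) (fps_lift l)"
  by (simp add: is_log_def fps_lift_fps_deriv[symmetric] fps_lift.hom_mult[symmetric])

lemma is_log_fps_log:
  fixes f :: "'a::idom fps"
  assumes "comm_ring_hom \<iota>" and f_nth_0: "fps_nth f 0 = 1"
  shows "is_log f (fps_log \<iota> f)"
proof -
  interpret comm_ring_hom \<iota> by fact
  interpret map: comm_ring_hom "fps_map \<iota>"
    using assms(1) by (rule comm_ring_hom_fps_map)
  let ?l = "fps_map \<iota> (fps_ln 1)"
  have "(1 + fps_X) * fps_deriv (fps_ln 1 :: real fps) = 1"
    by (simp add: fps_ln_deriv inverse_mult_eq_1')
  then have "fps_map \<iota> (1 + fps_X) * fps_map \<iota> (fps_deriv (fps_ln 1)) = 1"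
    by (simp add: map.hom_mult[symmetric])
  moreover have "fps_map \<iota> fps_X = fps_X"
    by (simp add: fps_eq_iff fps_X_def)
  ultimately have "(1 + fps_X) * fps_deriv ?l = 1"
    by (simp add: map.hom_add fps_map_hom_fps_deriv[OF assms(1)])
  then have "fps_compose ((1 + fps_X) * fps_deriv ?l) (f - 1) = 1"
    by simp
  then have inverse: "f * fps_compose (fps_deriv ?l) (f - 1) = 1"
    using f_nth_0 by (simp add: fps_compose_mult_distrib fps_compose_add_distrib)
  have "fps_deriv (fps_log \<iota> f) = fps_compose (fps_deriv ?l) (f - 1) * fps_deriv f"
    unfolding fps_log_def using f_nth_0 by (simp add: fps_compose_deriv)
  then have "f * fps_deriv (fps_log \<iota> f) = fps_deriv f"
    using inverse by (simp add: mult.assoc[symmetric])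
  moreover have "fps_nth (fps_log \<iota> f) 0 = 0"
    by (simp add: fps_log_def fps_ln_def)
  ultimately show ?thesis
    using f_nth_0 by (simp add: is_log_def)
qed

lemma is_log_partial_derivation:
  fixes f l :: "'a::{idom,ring_char_0} fps"
  assumes log: "is_log f l" and partial: "partial_derivation \<delta>"
  shows "f * \<delta> l = \<delta> f"
  using partial unfolding partial_derivation_def
proof
  assume "\<exists>\<epsilon>. derivation \<epsilon> \<and> \<delta> = fps_map \<epsilon>"
  then obtain \<epsilon> where derivation_coeff: "derivation \<epsilon>" and \<delta>_eq: "\<delta> = fps_map \<epsilon>" by blast
  interpret derivation \<delta>
    unfolding \<delta>_eq using derivation_coeff by (rule derivation_fps_map)
  define g where "g = fps_recip f"
  have recip: "f * g = 1"
    using log by (simp add: g_def fps_recip is_log_def)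
  have recip_deriv: "D g = - (g * g * D f)" if "derivation D" for D
  proof -
    interpret D: derivation D by fact
    have "0 = g * D (f * g)" by (simp add: recip)
    also have "\<dots> = g * g * D f + (f * g) * D g"
      by (simp add: D.mult algebra_simps)
    finally show ?thesis
      by (simp add: recip eq_neg_iff_add_eq_0 add.commute)
  qed
  have commute: "\<delta> (fps_deriv h) = fps_deriv (\<delta> h)" for h
    unfolding \<delta>_eq using derivation_coeff by (rule fps_map_fps_deriv)
  have "fps_deriv l = (f * g) * fps_deriv l"
    by (simp add: recip)
  also have "\<dots> = g * fps_deriv f"
    using log by (simp add: is_log_def mult_ac)
  finally have "fps_deriv (\<delta> l) = \<delta> (g * fps_deriv f)"
    by (simp add: commute[symmetric])
  also have "\<dots> = fps_deriv (g * \<delta> f)"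
    by (simp add: mult commute
        recip_deriv[OF derivation_axioms] recip_deriv[OF derivation_fps_deriv])
  finally have "fps_deriv (\<delta> l) = fps_deriv (g * \<delta> f)" .
  moreover have "fps_nth (\<delta> l) 0 = fps_nth (g * \<delta> f) 0"
    using log
    by (simp add: is_log_def \<delta>_eq
        derivation.zero[OF derivation_coeff] derivation.one[OF derivation_coeff])
  ultimately have "\<delta> l = g * \<delta> f"
    by (rule fps_deriv_inject)
  then show ?thesis
    using recip by (simp add: mult.assoc[symmetric])
qed (use log in \<open>simp add: is_log_def\<close>)

lemma is_log_supp:
  fixes f l :: "'a::{idom,ring_char_0} laurent fps"
  assumes log: "is_log f l" and half_line: "A = {0..} \<or> A = {..0}"
    and supp_f: "supp_in A f" "xcoeff 0 f = 1"
  shows "supp_in A l" "xcoeff 0 l = 0"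
proof -
  have f_nth_0: "fps_nth f 0 = 1" using log by (simp add: is_log_def)
  have supp_recip: "supp_in A (fps_recip f)"
    by (rule supp_in_fps_recip) (use supp_f half_line in auto)
  have supp_deriv: "supp_in A (fps_deriv f)"
    by (rule supp_in_fps_deriv[OF supp_f(1)])
  have "fps_deriv l = (f * fps_recip f) * fps_deriv l"
    by (simp add: fps_recip[OF f_nth_0])
  also have "\<dots> = fps_recip f * fps_deriv f"
    using log by (simp add: is_log_def mult_ac)
  finally have log_deriv: "fps_deriv l = fps_recip f * fps_deriv f" .
  have "supp_in A (fps_deriv l)"
    unfolding log_deriv
    using half_line supp_recip supp_deriv supp_in_nonneg_mult supp_in_nonpos_mult by blast
  moreover have "xcoeff 0 (fps_deriv l) = 0"
    unfolding log_deriv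
    by (subst xcoeff_0_mult)
       (use half_line supp_recip supp_deriv supp_f in \<open>auto simp: xcoeff_fps_deriv\<close>)
  moreover have "xcoeff k l = 0" if "xcoeff k (fps_deriv l) = 0" for k
    by (rule fps_deriv_inject) (use that log in \<open>simp_all add: xcoeff_fps_deriv is_log_def\<close>)
  ultimately show "supp_in A l" "xcoeff 0 l = 0"
    by (auto simp: supp_in_iff)
qed

text \<open>The derivatives \<open>\<delta> f / f\<close> of the logarithm stay in the algebra.\<close>

lemma D_finite_log:
  fixes f l :: "'a::{idom,ring_char_0} fps"
  assumes algebra: "rat_algebra G" "f \<in> rat_span G" and log: "is_log f l"
    and partial: "\<And>\<delta>. \<delta> \<in> \<Delta> \<Longrightarrow> partial_derivation \<delta>"
  shows "D_finite \<Delta> l"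
proof -
  have "f \<noteq> 0" using log by (auto simp: is_log_def)
  have log_deriv: "\<delta> l \<in> rat_span G" if "\<delta> \<in> \<Delta>" for \<delta>
  proof (rule rat_algebra_cancel[OF algebra \<open>f \<noteq> 0\<close>])
    show "f * \<delta> l \<in> rat_span G"
      unfolding is_log_partial_derivation[OF log partial[OF that]]
      by (rule rat_algebra_derivation[OF algebra ratfun_derivation_if_partial[OF partial[OF that]]])
  qed
  have "\<delta> g \<in> rat_span G" if "\<delta> \<in> \<Delta>" "g \<in> insert l G" for \<delta> g
    using that log_deriv partial
      rat_algebra_derivation[OF algebra(1) rat_span_base ratfun_derivation_if_partial]
    by auto
  then have "deriv_closed \<Delta> (insert l G)"
    using rat_algebra_finite[OF algebra(1)] rat_span_mono[of G "insert l G"]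
    unfolding deriv_closed_def by blast
  with partial show ?thesis
    by (rule D_finite_if_in_deriv_closed) simp_all
qed


subsection \<open>Series without \<open>x\<close>\<close>

abbreviation xt_derivs :: "('a::idom laurent fps \<Rightarrow> 'a laurent fps) set" where
  "xt_derivs \<equiv> {fps_deriv, x_deriv}"

abbreviation xyt_derivs :: "('a::idom laurent laurent fps \<Rightarrow> 'a laurent laurent fps) set" where
  "xyt_derivs \<equiv> {fps_deriv, x_deriv, fps_map (Poly_Mapping.map laurent_deriv)}"

lemma partial_derivation_t: "partial_derivation fps_deriv"
  and partial_derivation_xt: "\<delta> \<in> xt_derivs \<Longrightarrow> partial_derivation \<delta>"
  and partial_derivation_xyt: "\<delta>' \<in> xyt_derivs \<Longrightarrow> partial_derivation \<delta>'"
  unfolding partial_derivation_def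
  using derivation_laurent_deriv derivation_map[OF derivation_laurent_deriv] by auto

lemma rat_span_lift:
  fixes f :: "'a::idom fps"
  assumes "f \<in> rat_span G" "finite G"
  shows "fps_lift f \<in> rat_span (fps_lift ` G)"
proof -
  obtain q p where relation: "q \<noteq> 0" "fps_of_poly q * f = (\<Sum>g\<in>G. fps_of_poly (p f g) * g)"
    by (rule rat_span_common_denominator[of "{f}" G]) (use assms in auto)
  have "fps_of_poly (map_poly laurent_const q) * fps_lift f =
      (\<Sum>g\<in>G. fps_of_poly (map_poly laurent_const (p f g)) * fps_lift g)"
    using arg_cong[OF relation(2), of fps_lift]
    by (simp add: fps_lift.hom_mult fps_lift.hom_sum fps_lift_fps_of_poly)
  also have "\<dots> \<in> rat_span (fps_lift ` G)"
    by (intro rat_span_sum rat_span_poly_mult rat_span_base imageI)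
  finally show ?thesis
    by (rule rat_span_cancel_poly[rotated])
       (use relation(1) in \<open>simp add: map_poly_eq_0_iff laurent_const_eq_0_iff\<close>)
qed

definition derivs_lift ::
    "('a::zero fps \<Rightarrow> 'a fps) set \<Rightarrow> ('a laurent fps \<Rightarrow> 'a laurent fps) set \<Rightarrow> bool" where
  "derivs_lift \<Delta> \<Delta>' \<longleftrightarrow>
    (\<forall>\<delta>'\<in>\<Delta>'. \<exists>\<delta>\<in>insert (\<lambda>_. 0) \<Delta>. \<forall>f. \<delta>' (fps_lift f) = fps_lift (\<delta> f))"

lemma derivs_lift_t_xt: "derivs_lift {fps_deriv} xt_derivs"
  by (simp add: derivs_lift_def fps_lift_fps_deriv fps_map_laurent_deriv_lift)

lemma derivs_lift_xt_xyt: "derivs_lift xt_derivs xyt_derivs"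
  by (simp add: derivs_lift_def fps_lift_fps_deriv fps_map_laurent_deriv_lift fps_map_map_lift
      derivation.zero[OF derivation_laurent_deriv])

lemma deriv_closed_lift:
  fixes G :: "'a::idom fps set"
  assumes closed: "deriv_closed \<Delta> G" and "derivs_lift \<Delta> \<Delta>'"
  shows "deriv_closed \<Delta>' (fps_lift ` G)"
  unfolding deriv_closed_def
proof (intro conjI ballI)
  show "finite (fps_lift ` G)"
    using closed by (simp add: deriv_closed_def)
  fix \<delta>' h assume "\<delta>' \<in> \<Delta>'" "h \<in> fps_lift ` G"
  then obtain g \<delta> where "g \<in> G" "\<delta> = (\<lambda>_. 0) \<or> \<delta> \<in> \<Delta>" "\<delta>' h = fps_lift (\<delta> g)"
    using assms(2) unfolding derivs_lift_def by blast
  then show "\<delta>' h \<in> rat_span (fps_lift ` G)"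
    using closed rat_span_lift[of "\<delta> g" G] by (auto simp: deriv_closed_def rat_span_0)
qed

lemma D_finite_lift:
  fixes f :: "'a::idom fps"
  assumes "D_finite \<Delta> f" "derivs_lift \<Delta> \<Delta>'" "\<And>\<delta>. \<delta> \<in> \<Delta>' \<Longrightarrow> partial_derivation \<delta>"
  shows "D_finite \<Delta>' (fps_lift f)"
proof -
  obtain G where closed: "deriv_closed \<Delta> G" "f \<in> G"
    using assms(1) by (rule D_finiteE)
  show ?thesis
    using assms(3) deriv_closed_lift[OF closed(1) assms(2)] imageI[OF closed(2)]
    by (rule D_finite_if_in_deriv_closed)
qed


subsection \<open>Walks that avoid a set\<close>

definition avoiding_walks :: "(int \<times> int) set \<Rightarrow> (int \<times> int) set \<Rightarrow> (int \<times> int) list set" where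
  "avoiding_walks \<SS> H = {w \<in> walks \<SS>. \<forall>k\<in>{1..walk_length w}. w ! k \<notin> H}"

definition walks_to :: "(int \<times> int) list set \<Rightarrow> nat \<Rightarrow> int \<times> int \<Rightarrow> (int \<times> int) list set" where
  "walks_to W n p = {w \<in> W. walk_length w = n \<and> last w = p}"

lemma num_walks_eq: "num_walks W n p = card (walks_to W n p)"
  by (simp add: num_walks_def walks_to_def)

lemma walks_to_0: "walks_to (avoiding_walks \<SS> H) 0 p = (if p = (0, 0) then {[(0, 0)]} else {})"
proof -
  have "w \<in> avoiding_walks \<SS> H \<and> walk_length w = 0 \<longleftrightarrow> w = [(0, 0)]" for w
    by (cases w) (auto simp: avoiding_walks_def walks_def walk_length_def)
  then have "walks_to (avoiding_walks \<SS> H) 0 p = {w. w = [(0, 0)] \<and> last w = p}"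
    unfolding walks_to_def by (metis (no_types, lifting))
  also have "\<dots> = (if p = (0, 0) then {[(0, 0)]} else {})"
    by (simp cong: conj_cong)
  finally show ?thesis .
qed

lemma snoc_in_avoiding_walks_iff:
  assumes "w \<noteq> []"
  shows "w @ [p] \<in> avoiding_walks \<SS> H \<longleftrightarrow> w \<in> avoiding_walks \<SS> H \<and> p - last w \<in> \<SS> \<and> p \<notin> H"
proof -
  obtain m where length_w: "length w = Suc m" using assms by (cases w) auto
  have ranges: "{1..<Suc (Suc m)} = insert (Suc m) {1..<Suc m}" "{1..Suc m} = insert (Suc m) {1..m}"
    by auto
  have nth: "(w @ [p]) ! k = w ! k" "(w @ [p]) ! (k - Suc 0) = w ! (k - Suc 0)" if "k < Suc m" for k
    using that length_w by (simp_all add: nth_append less_imp_diff_less)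
  have last: "(w @ [p]) ! Suc m = p" "last w = w ! m"
    using assms length_w by (simp_all add: last_conv_nth nth_append)
  have "(\<forall>k\<in>{1..<Suc (Suc m)}. (w @ [p]) ! k - (w @ [p]) ! (k - 1) \<in> \<SS>) \<longleftrightarrow>
      p - last w \<in> \<SS> \<and> (\<forall>k\<in>{1..<Suc m}. w ! k - w ! (k - 1) \<in> \<SS>)"
    unfolding ranges by (simp add: last nth)
  moreover have "(\<forall>k\<in>{1..Suc m}. (w @ [p]) ! k \<notin> H) \<longleftrightarrow> p \<notin> H \<and> (\<forall>k\<in>{1..m}. w ! k \<notin> H)"
    unfolding ranges by (simp add: last nth)
  ultimately show ?thesis
    unfolding avoiding_walks_def walks_def walk_length_def
    using assms nth(1)[of 0] length_w by simp blast
qed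

lemma walks_to_Suc:
  "walks_to (avoiding_walks \<SS> H) (Suc n) p =
    (if p \<in> H then {} else (\<lambda>w. w @ [p]) ` (\<Union>s\<in>\<SS>. walks_to (avoiding_walks \<SS> H) n (p - s)))"
    (is "?L = ?R")
proof (rule Set.set_eqI)
  fix v
  show "v \<in> ?L \<longleftrightarrow> v \<in> ?R"
  proof
    assume v_in_L: "v \<in> ?L"
    then have "length v = Suc (Suc n)" "last v = p"
      by (auto simp: walks_to_def walk_length_def)
    then obtain w where snoc: "v = w @ [p]" "length w = Suc n"
      by (cases v rule: rev_cases) auto
    then have "w \<noteq> []" by auto
    then have "w \<in> avoiding_walks \<SS> H" "p - last w \<in> \<SS>" "p \<notin> H"
      using v_in_L snoc by (auto simp: walks_to_def snoc_in_avoiding_walks_iff)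
    then show "v \<in> ?R"
      using snoc
      by (auto simp: walks_to_def walk_length_def
          intro!: image_eqI[of _ _ w] bexI[of _ "p - last w"])
  next
    assume "v \<in> ?R"
    then obtain w s where snoc: "p \<notin> H" "v = w @ [p]" "s \<in> \<SS>"
        "w \<in> walks_to (avoiding_walks \<SS> H) n (p - s)"
      by (auto split: if_splits)
    then have "w \<noteq> []" by (auto simp: walks_to_def avoiding_walks_def walks_def)
    then show "v \<in> ?L"
      using snoc by (auto simp: walks_to_def snoc_in_avoiding_walks_iff walk_length_def Suc_diff_le)
  qed
qed

lemma num_walks_avoiding_0: "num_walks (avoiding_walks \<SS> H) 0 p = (if p = (0, 0) then 1 else 0)"
  by (simp add: num_walks_eq walks_to_0)

lemma num_walks_avoiding_Suc:
  assumes "finite \<SS>"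
  shows "num_walks (avoiding_walks \<SS> H) (Suc n) p =
    (if p \<in> H then 0 else (\<Sum>s\<in>\<SS>. num_walks (avoiding_walks \<SS> H) n (p - s)))"
proof -
  let ?W = "walks_to (avoiding_walks \<SS> H)"
  have finite: "finite (?W n q)" for q
    by (induction n arbitrary: q) (auto simp: walks_to_0 walks_to_Suc assms)
  have "card ((\<lambda>w. w @ [p]) ` (\<Union>s\<in>\<SS>. ?W n (p - s))) = card (\<Union>s\<in>\<SS>. ?W n (p - s))"
    by (rule card_image) (auto simp: inj_on_def)
  also have "\<dots> = (\<Sum>s\<in>\<SS>. card (?W n (p - s)))"
    by (rule card_UN_disjoint) (use assms finite in \<open>auto, auto simp: walks_to_def\<close>)
  finally show ?thesis
    by (simp add: num_walks_eq walks_to_Suc)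
qed

lemma finite_endpoints:
  assumes "finite \<SS>"
  shows "finite {p. num_walks (avoiding_walks \<SS> H) n p \<noteq> 0}"
proof (induction n)
  case 0
  have "{p. num_walks (avoiding_walks \<SS> H) 0 p \<noteq> 0} \<subseteq> {(0, 0)}"
    by (auto simp: num_walks_avoiding_0 split: if_splits)
  then show ?case by (rule finite_subset) simp
next
  case (Suc n)
  let ?E = "{p. num_walks (avoiding_walks \<SS> H) n p \<noteq> 0}"
  have "p \<in> (\<lambda>(q, s). q + s) ` (?E \<times> \<SS>)"
    if "num_walks (avoiding_walks \<SS> H) (Suc n) p \<noteq> 0" for p
  proof -
    have "(\<Sum>s\<in>\<SS>. num_walks (avoiding_walks \<SS> H) n (p - s)) \<noteq> 0"
      using that by (auto simp: num_walks_avoiding_Suc[OF assms] split: if_splits)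
    then obtain s where "s \<in> \<SS>" "num_walks (avoiding_walks \<SS> H) n (p - s) \<noteq> 0"
      by (meson sum.not_neutral_contains_not_neutral)
    then show ?thesis
      by (intro image_eqI[of _ _ "(p - s, s)"]) auto
  qed
  then have "{p. num_walks (avoiding_walks \<SS> H) (Suc n) p \<noteq> 0} \<subseteq> (\<lambda>(q, s). q + s) ` (?E \<times> \<SS>)"
    by blast
  then show ?case
    by (rule finite_subset) (use Suc assms in auto)
qed


subsection \<open>Generating functions of walks\<close>

lemma lookup_gf_xy:
  assumes "finite {p. num_walks W n p \<noteq> 0}"
  shows "Poly_Mapping.lookup (Poly_Mapping.lookup (fps_nth (gf_xy W) n) j) i =
      real (num_walks W n (i, j))"
proof -
  have "{(i, j). num_walks W n (i, j) \<noteq> 0} = {p. num_walks W n p \<noteq> 0}"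
    by auto
  then have "Poly_Mapping.lookup (Poly_Mapping.lookup (fps_nth (gf_xy W) n) j) i =
      (\<Sum>p | num_walks W n p \<noteq> 0. if p = (i, j) then real (num_walks W n (i, j)) else 0)"
    unfolding gf_xy_def fps_nth_Abs_fps lookup_sum
    by (intro sum.cong) (auto simp: lookup_single when_def split: if_splits)
  also have "\<dots> = real (num_walks W n (i, j))"
    using assms by auto
  finally show ?thesis .
qed

lemma gf_x_eq_xcoeff:
  assumes "\<And>n. finite {p. num_walks W n p \<noteq> 0}"
  shows "gf_x W = xcoeff 0 (gf_xy W)"
proof (intro fps_ext poly_mapping_eqI)
  fix n i
  have "{i. num_walks W n (i, 0) \<noteq> 0} \<subseteq> fst ` {p. num_walks W n p \<noteq> 0}"
    by force
  then have "finite {i. num_walks W n (i, 0) \<noteq> 0}"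
    by (rule finite_subset) (use assms in simp)
  then have "Poly_Mapping.lookup (fps_nth (gf_x W) n) i = real (num_walks W n (i, 0))"
    by (auto simp: gf_x_def lookup_sum lookup_single when_def)
  then show "Poly_Mapping.lookup (fps_nth (gf_x W) n) i =
      Poly_Mapping.lookup (fps_nth (xcoeff 0 (gf_xy W)) n) i"
    by (simp add: lookup_gf_xy[OF assms])
qed

lemma gf_x_avoiding: "finite \<SS> \<Longrightarrow> gf_x (avoiding_walks \<SS> H) = xcoeff 0 (gf_xy (avoiding_walks \<SS> H))"
  by (rule gf_x_eq_xcoeff) (rule finite_endpoints)

lemma num_walks_cong:
  assumes "\<And>w. last w = p \<Longrightarrow> w \<in> V \<longleftrightarrow> w \<in> W"
  shows "num_walks V n p = num_walks W n p"
proof -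
  have "{w \<in> V. walk_length w = n \<and> last w = p} = {w \<in> W. walk_length w = n \<and> last w = p}"
    using assms by auto
  then show ?thesis by (simp add: num_walks_def)
qed

lemma walks_eq_avoiding: "walks \<SS> = avoiding_walks \<SS> {}"
  by (simp add: avoiding_walks_def)

lemma slit_walks_eq_avoiding: "slit_walks \<SS> = avoiding_walks \<SS> ({..0} \<times> {0})"
  by (auto simp: slit_walks_def avoiding_walks_def on_slit_plane_def)

lemma gf_x_bilateral_walks: "gf_x (bilateral_walks \<SS>) = gf_x (walks \<SS>)"
proof -
  have "num_walks (bilateral_walks \<SS>) n (i, 0) = num_walks (walks \<SS>) n (i, 0)" for n i
    by (rule num_walks_cong) (simp add: bilateral_walks_def bilateral_def)
  then show ?thesis by (simp add: gf_x_def)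
qed

lemma gf_x_bilateral_slit_walks: "gf_x (bilateral_slit_walks \<SS>) = gf_x (slit_walks \<SS>)"
proof -
  have "num_walks (bilateral_slit_walks \<SS>) n (i, 0) = num_walks (slit_walks \<SS>) n (i, 0)" for n i
    by (rule num_walks_cong) (simp add: bilateral_slit_walks_def slit_walks_def bilateral_def)
  then show ?thesis by (simp add: gf_x_def)
qed

lemma gf_t_loops:
  assumes "finite \<SS>"
  shows "gf_t (loops \<SS>) = xcoeff 0 (gf_x (avoiding_walks \<SS> ({..<0} \<times> {0})))"
proof -
  have "num_walks (loops \<SS>) n (0, 0) = num_walks (avoiding_walks \<SS> ({..<0} \<times> {0})) n (0, 0)" for n
  proof (rule num_walks_cong)
    fix w :: "(int \<times> int) list" assume last: "last w = (0, 0)"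
    have "{0..walk_length w} = insert 0 {1..walk_length w}" by auto
    then have "(\<forall>k\<in>{0..walk_length w}. w ! k \<notin> {(i, 0) |i. i < 0}) \<longleftrightarrow>
        (\<forall>k\<in>{1..walk_length w}. w ! k \<notin> {..<0} \<times> {0})" if "w ! 0 = (0, 0)"
      using that by auto
    then show "w \<in> loops \<SS> \<longleftrightarrow> w \<in> avoiding_walks \<SS> ({..<0} \<times> {0})"
      using last by (auto simp: loops_def avoiding_walks_def walks_def is_loop_def)
  qed
  then show ?thesis
    by (simp add: fps_eq_iff gf_t_def gf_x_avoiding[OF assms]
        lookup_gf_xy[OF finite_endpoints[OF assms]])
qed

definition step_poly :: "(int \<times> int) set \<Rightarrow> real laurent laurent" where
  "step_poly \<SS> = (\<Sum>(i, j)\<in>\<SS>. Poly_Mapping.single j (Poly_Mapping.single i 1))"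

lemma walk_kernel_eq: "walk_kernel \<SS> = 1 - fps_X * fps_const (step_poly \<SS>)"
  by (simp add: walk_kernel_def step_poly_def)

lemma walk_kernel_nth_0 [simp]: "fps_nth (walk_kernel \<SS>) 0 = 1"
  by (simp add: walk_kernel_eq)

lemma lookup_step_poly_mult:
  "Poly_Mapping.lookup (Poly_Mapping.lookup (step_poly \<SS> * q) j) i =
    (\<Sum>(a, b)\<in>\<SS>. Poly_Mapping.lookup (Poly_Mapping.lookup q (j - b)) (i - a))"
  unfolding step_poly_def sum_distrib_right lookup_sum
  by (intro sum.cong) (auto simp: lookup_single_mult)

lemma kernel_equation:
  assumes "finite \<SS>" "(i, j) \<notin> H"
  shows "xcoeff i (xcoeff j (gf_xy (avoiding_walks \<SS> H) * walk_kernel \<SS>)) = xcoeff i (xcoeff j 1)"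
proof (rule fps_ext)
  fix n
  let ?N = "num_walks (avoiding_walks \<SS> H)"
  let ?F = "gf_xy (avoiding_walks \<SS> H)"
  note lookup_F = lookup_gf_xy[OF finite_endpoints[OF assms(1)]]
  have mult_kernel: "?F * walk_kernel \<SS> = ?F - fps_X * (fps_const (step_poly \<SS>) * ?F)"
    by (simp add: walk_kernel_eq algebra_simps)
  show "fps_nth (xcoeff i (xcoeff j (?F * walk_kernel \<SS>))) n = fps_nth (xcoeff i (xcoeff j 1)) n"
  proof (cases n)
    case 0
    then show ?thesis
      by (auto simp: mult_kernel lookup_minus lookup_F num_walks_avoiding_0 lookup_one when_def)
  next
    case (Suc m)
    have "real (?N (Suc m) (i, j)) = (\<Sum>(a, b)\<in>\<SS>. real (?N m (i - a, j - b)))"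
      using assms by (simp add: num_walks_avoiding_Suc case_prod_beta' minus_prod_def)
    then show ?thesis
      by (simp add: mult_kernel Suc lookup_minus lookup_F lookup_step_poly_mult)
  qed
qed

lemma gf_walks_mult_kernel:
  assumes "finite \<SS>"
  shows "gf_xy (walks \<SS>) * walk_kernel \<SS> = 1"
  unfolding walks_eq_avoiding by (intro laurent_fps_eqI) (simp add: kernel_equation[OF assms])

lemma avoiding_axis_factor:
  assumes "finite \<SS>"
  obtains \<tau> where "supp_in A \<tau>"
    "gf_xy (avoiding_walks \<SS> (A \<times> {0})) = (1 - fps_lift \<tau>) * gf_xy (walks \<SS>)"
    "gf_x (avoiding_walks \<SS> (A \<times> {0})) = (1 - \<tau>) * gf_x (walks \<SS>)"
proof -
  let ?F = "gf_xy (avoiding_walks \<SS> (A \<times> {0}))" and ?W = "gf_xy (walks \<SS>)"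
  define T where "T = 1 - ?F * walk_kernel \<SS>"
  define \<tau> where "\<tau> = xcoeff 0 T"
  have outside: "xcoeff i (xcoeff j T) = 0" if "(i, j) \<notin> A \<times> {0}" for i j
    using kernel_equation[OF assms that] by (simp add: T_def xcoeff_diff)
  then have "supp_in {0} T"
    unfolding supp_in_iff by (intro allI impI laurent_fps_eqI) auto
  then have T_lift: "T = fps_lift \<tau>"
    unfolding \<tau>_def by (rule supp_in_singleton_0)
  have "?F = ?F * (?W * walk_kernel \<SS>)"
    by (simp add: gf_walks_mult_kernel[OF assms])
  also have "\<dots> = (1 - T) * ?W"
    by (simp add: T_def algebra_simps)
  finally have F_eq: "?F = (1 - fps_lift \<tau>) * ?W"
    unfolding T_lift .
  show thesis
  proof (rule that[OF _ F_eq])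
    show "supp_in A \<tau>"
      unfolding supp_in_iff \<tau>_def using outside by auto
    have "xcoeff 0 ?F = (1 - \<tau>) * xcoeff 0 ?W"
      unfolding F_eq by (simp add: xcoeff_diff xcoeff_lift_mult algebra_simps)
    then show "gf_x (avoiding_walks \<SS> (A \<times> {0})) = (1 - \<tau>) * gf_x (walks \<SS>)"
      by (simp add: gf_x_avoiding[OF assms] walks_eq_avoiding)
  qed
qed


subsection \<open>The canonical factorization of the bilateral series\<close>

lemma nonpos_factor_eq_lift:
  fixes u v :: "'a::comm_ring_1 laurent fps"
  assumes "supp_in {..0} u" "supp_in {0..} v" "fps_nth v 0 = 1" "supp_in {0..} (u * v)"
  shows "u = fps_lift (xcoeff 0 u)"
proof -
  have "u = (u * v) * fps_recip v"
    by (simp add: mult.assoc fps_recip[OF assms(3)])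
  also have "supp_in {0..} \<dots>"
    by (intro supp_in_nonneg_mult assms supp_in_fps_recip) auto
  finally have "supp_in {0} u"
    using assms(1) by (force simp: supp_in_iff)
  then show ?thesis
    by (rule supp_in_singleton_0)
qed

lemma xcoeff_gf_x_avoiding:
  assumes "finite \<SS>" "(i, 0) \<in> H"
  shows "xcoeff i (gf_x (avoiding_walks \<SS> H)) = (if i = 0 then 1 else 0)"
proof (rule fps_ext)
  fix n
  show "fps_nth (xcoeff i (gf_x (avoiding_walks \<SS> H))) n = fps_nth (if i = 0 then 1 else 0) n"
    using assms by (cases n) (auto simp: gf_x_avoiding lookup_gf_xy[OF finite_endpoints]
        num_walks_avoiding_0 num_walks_avoiding_Suc)
qed

locale walk_factorization =
  fixes \<SS> :: "(int \<times> int) set" and B0 :: "real fps" and Bp Bm :: "real laurent fps"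
  assumes finite_steps: "finite \<SS>"
    and factorization: "canonical_factorization (gf_x (bilateral_walks \<SS>)) B0 Bp Bm"
begin

lemma bilateral_gf_eq: "gf_x (walks \<SS>) = fps_lift B0 * Bp * Bm"
  and B0_nth_0: "fps_nth B0 0 = 1"
  and supp_Bp: "supp_in {0..} Bp"
  and Bp_nth_0: "fps_nth Bp 0 = 1"
  and xcoeff_0_Bp: "xcoeff 0 Bp = 1"
  and supp_Bm: "supp_in {..0} Bm"
  and Bm_nth_0: "fps_nth Bm 0 = 1"
  and xcoeff_0_Bm: "xcoeff 0 Bm = 1"
  using factorization unfolding canonical_factorization_def gf_x_bilateral_walks
  by (simp_all add: supp_in_def xcoeff_def)

lemma avoiding_gf_factorization:
  assumes "{..<0} \<subseteq> A" "A \<subseteq> {..0}"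
  obtains c where "gf_x (avoiding_walks \<SS> (A \<times> {0})) = fps_lift c * (fps_lift B0 * Bp)"
    "gf_xy (avoiding_walks \<SS> (A \<times> {0})) * (walk_kernel \<SS> * fps_lift Bm) = fps_lift (fps_lift c)"
    "0 \<notin> A \<Longrightarrow> c = 1"
proof -
  let ?F = "avoiding_walks \<SS> (A \<times> {0})"
  obtain \<tau> where axis_factor: "supp_in A \<tau>" "gf_xy ?F = (1 - fps_lift \<tau>) * gf_xy (walks \<SS>)"
      "gf_x ?F = (1 - \<tau>) * gf_x (walks \<SS>)"
    using avoiding_axis_factor[OF finite_steps] by blast
  have nonpos: "supp_in {..0} (1 - \<tau>)"
    using supp_in_mono[OF axis_factor(1) assms(2)] by (auto intro: supp_in_diff supp_in_1)
  define u where "u = (1 - \<tau>) * Bm"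
  have gf_x_F: "gf_x ?F = u * (fps_lift B0 * Bp)"
    by (simp add: axis_factor(3) u_def bilateral_gf_eq mult_ac)
  have "xcoeff i (gf_x ?F) = 0" if "i < 0" for i
    using that assms(1) by (subst xcoeff_gf_x_avoiding[OF finite_steps]) auto
  then have "supp_in {0..} (gf_x ?F)"
    by (auto simp: supp_in_iff)
  then have u_lift: "u = fps_lift (xcoeff 0 u)"
    unfolding gf_x_F
    by (intro nonpos_factor_eq_lift[of u "fps_lift B0 * Bp"])
       (auto simp: u_def B0_nth_0 Bp_nth_0
         intro!: supp_in_nonpos_mult supp_in_nonneg_mult supp_in_lift nonpos supp_Bp supp_Bm)
  show thesis
  proof (rule that)
    show "gf_x ?F = fps_lift (xcoeff 0 u) * (fps_lift B0 * Bp)"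
      using gf_x_F u_lift by simp
    have "gf_xy ?F * (walk_kernel \<SS> * fps_lift Bm) = (gf_xy (walks \<SS>) * walk_kernel \<SS>) * fps_lift u"
      by (simp add: axis_factor(2) u_def fps_lift.hom_mult fps_lift.hom_diff mult_ac)
    then show "gf_xy ?F * (walk_kernel \<SS> * fps_lift Bm) = fps_lift (fps_lift (xcoeff 0 u))"
      using u_lift gf_walks_mult_kernel[OF finite_steps] by simp
    have "xcoeff 0 u = xcoeff 0 (1 - \<tau>)"
      unfolding u_def using nonpos supp_Bm by (simp add: xcoeff_0_mult xcoeff_0_Bm)
    then show "xcoeff 0 u = 1" if "0 \<notin> A"
      using axis_factor(1) that by (simp add: xcoeff_diff xcoeff_1 supp_in_iff)
  qed
qed

lemma gf_loops: "gf_t (loops \<SS>) = B0"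
proof -
  obtain c where "gf_x (avoiding_walks \<SS> ({..<0} \<times> {0})) = fps_lift c * (fps_lift B0 * Bp)" "c = 1"
    by (rule avoiding_gf_factorization[of "{..<0}"]) auto
  then show ?thesis
    by (simp add: gf_t_loops[OF finite_steps] xcoeff_lift_mult xcoeff_0_Bp)
qed

lemma gf_bilateral_slit_walks: "gf_x (bilateral_slit_walks \<SS>) = Bp" (is ?bilateral)
  and gf_slit_walks:
    "gf_xy (slit_walks \<SS>) * (walk_kernel \<SS> * fps_lift (fps_lift B0) * fps_lift Bm) = 1" (is ?all)
proof -
  obtain c where slit_factorization: "gf_x (slit_walks \<SS>) = fps_lift c * (fps_lift B0 * Bp)"
      "gf_xy (slit_walks \<SS>) * (walk_kernel \<SS> * fps_lift Bm) = fps_lift (fps_lift c)"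
    unfolding slit_walks_eq_avoiding by (rule avoiding_gf_factorization[of "{..0}"]) auto
  have "xcoeff 0 (gf_x (slit_walks \<SS>)) = 1"
    unfolding slit_walks_eq_avoiding by (subst xcoeff_gf_x_avoiding[OF finite_steps]) auto
  then have c_B0: "c * B0 = 1"
    by (simp add: slit_factorization(1) xcoeff_lift_mult xcoeff_0_Bp)
  then have "fps_lift c * fps_lift B0 = 1"
    by (simp add: fps_lift.hom_mult[symmetric])
  then show ?bilateral
    by (simp add: gf_x_bilateral_slit_walks slit_factorization(1) mult.assoc[symmetric])
  have "gf_xy (slit_walks \<SS>) * (walk_kernel \<SS> * fps_lift (fps_lift B0) * fps_lift Bm) =
      (gf_xy (slit_walks \<SS>) * (walk_kernel \<SS> * fps_lift Bm)) * fps_lift (fps_lift B0)"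
    by (simp add: mult_ac)
  also have "\<dots> = fps_lift (fps_lift (c * B0))"
    by (simp add: slit_factorization(2) fps_lift.hom_mult)
  finally show ?all
    by (simp add: c_B0)
qed

end


subsection \<open>Wiener--Hopf factorization\<close>

definition restrict_keys :: "int set \<Rightarrow> 'a::comm_monoid_add laurent \<Rightarrow> 'a laurent" where
  "restrict_keys A = Poly_Mapping.mapp (\<lambda>k c. if k \<in> A then c else 0)"

lemma lookup_restrict_keys:
  "Poly_Mapping.lookup (restrict_keys A p) k = (if k \<in> A then Poly_Mapping.lookup p k else 0)"
  by (simp add: restrict_keys_def lookup_mapp when_def in_keys_iff)

lemma keys_restrict_keys: "Poly_Mapping.keys (restrict_keys A p) = Poly_Mapping.keys p \<inter> A"
  by (auto simp: in_keys_iff lookup_restrict_keys split: if_splits)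

fun wiener_hopf_coeff :: "'a::comm_ring_1 laurent fps \<Rightarrow> nat \<Rightarrow> 'a laurent" where
  "wiener_hopf_coeff f n = fps_nth f n -
    (\<Sum>i\<in>{1..<n}. restrict_keys {..<0} (wiener_hopf_coeff f i) *
      restrict_keys {0..} (wiener_hopf_coeff f (n - i)))"

declare wiener_hopf_coeff.simps [simp del]

definition wiener_hopf_factor :: "int set \<Rightarrow> 'a::comm_ring_1 laurent fps \<Rightarrow> 'a laurent fps" where
  "wiener_hopf_factor A f =
    Abs_fps (\<lambda>n. if n = 0 then 1 else restrict_keys A (wiener_hopf_coeff f n))"

lemma wiener_hopf_factors_mult:
  assumes "fps_nth f 0 = 1"
  shows "wiener_hopf_factor {..<0} f * wiener_hopf_factor {0..} f = f"
proof (rule fps_ext)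
  fix n
  let ?g = "wiener_hopf_factor {..<0} f" and ?h = "wiener_hopf_factor {0..} f"
  have split: "restrict_keys {..<0} p + restrict_keys {0..} p = p" for p :: "'a laurent"
    by (rule poly_mapping_eqI) (simp add: lookup_add lookup_restrict_keys)
  show "fps_nth (?g * ?h) n = fps_nth f n"
  proof (cases "n = 0")
    case True
    then show ?thesis by (simp add: wiener_hopf_factor_def assms)
  next
    case False
    then have "{0..n} = insert 0 (insert n {1..<n})" by auto
    then have "fps_nth (?g * ?h) n = fps_nth ?g 0 * fps_nth ?h n + fps_nth ?g n * fps_nth ?h 0 +
        (\<Sum>i\<in>{1..<n}. fps_nth ?g i * fps_nth ?h (n - i))"
      using False by (simp add: fps_mult_nth add.assoc)
    also have "fps_nth ?g 0 * fps_nth ?h n + fps_nth ?g n * fps_nth ?h 0 = wiener_hopf_coeff f n"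
      using False split[of "wiener_hopf_coeff f n"]
      by (simp add: wiener_hopf_factor_def add.commute)
    also have "(\<Sum>i\<in>{1..<n}. fps_nth ?g i * fps_nth ?h (n - i)) =
        fps_nth f n - wiener_hopf_coeff f n"
      by (subst wiener_hopf_coeff.simps) (auto simp: wiener_hopf_factor_def intro!: sum.cong)
    finally show ?thesis by simp
  qed
qed

lemma keys_wiener_hopf_coeff:
  assumes "supp_in {- int d..int d} f"
  shows "Poly_Mapping.keys (wiener_hopf_coeff f n) \<subseteq> {- int d..int d}"
proof (induction n rule: less_induct)
  case (less n)
  have "Poly_Mapping.keys (\<Sum>i\<in>{1..<n}. restrict_keys {..<0} (wiener_hopf_coeff f i) *
      restrict_keys {0..} (wiener_hopf_coeff f (n - i))) \<subseteq> {- int d..int d}"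
  proof (intro keys_sum_subset keys_mult_subset)
    fix i assume i_range: "i \<in> {1..<n}"
    show "Poly_Mapping.keys (restrict_keys {..<0} (wiener_hopf_coeff f i)) \<subseteq> {- int d..<0}"
      using less[of i] i_range by (force simp: keys_restrict_keys)
    show "Poly_Mapping.keys (restrict_keys {0..} (wiener_hopf_coeff f (n - i))) \<subseteq> {0..int d}"
      using less[of "n - i"] i_range by (force simp: keys_restrict_keys)
  qed auto
  moreover have "Poly_Mapping.keys (fps_nth f n) \<subseteq> {- int d..int d}"
    using assms by (simp add: supp_in_def)
  ultimately show ?case
    by (subst wiener_hopf_coeff.simps) (intro subset_trans[OF keys_diff] Un_least)
qed

lemma wiener_hopf_factorization:
  fixes f :: "'a::comm_ring_1 laurent fps"
  assumes "fps_nth f 0 = 1" "supp_in {- int d..int d} f"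
  obtains g h where "f = g * h" "fps_nth g 0 = 1" "fps_nth h 0 = 1"
    "supp_in {- int d..0} g" "xcoeff 0 g = 1" "supp_in {0..int d} h"
proof (rule that)
  show "f = wiener_hopf_factor {..<0} f * wiener_hopf_factor {0..} f"
    by (rule wiener_hopf_factors_mult[OF assms(1), symmetric])
  show "supp_in {- int d..0} (wiener_hopf_factor {..<0} f)"
      "supp_in {0..int d} (wiener_hopf_factor {0..} f)"
    using keys_wiener_hopf_coeff[OF assms(2)]
    by (force simp: supp_in_def wiener_hopf_factor_def keys_restrict_keys)+
  show "xcoeff 0 (wiener_hopf_factor {..<0} f) = 1"
    by (simp add: fps_eq_iff wiener_hopf_factor_def lookup_restrict_keys)
qed (simp_all add: wiener_hopf_factor_def)

text \<open>
  As \<open>1/K = 1 - t K'/K\<close> for \<open>K = 1 - t P\<close>, the series \<open>1/K\<close> is a logarithmic derivative, so it is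
  additive over the factors of \<open>K\<close>.
\<close>

lemma xcoeff_0_inverse_kernel:
  fixes K :: "'a::comm_ring_1 laurent fps"
  assumes inverse: "W * K = 1" and log_derivative: "K - fps_X * fps_deriv K = 1"
    and factors: "K = g * h"
    and neg_factor: "fps_nth g 0 = 1" "supp_in {..0} g" "xcoeff 0 g = 1"
    and nonneg_factor: "fps_nth h 0 = 1" "supp_in {0..} h"
  shows "xcoeff 0 h * xcoeff 0 W = xcoeff 0 h - fps_X * fps_deriv (xcoeff 0 h)"
proof -
  let ?g = "fps_recip g" and ?h = "fps_recip h"
  have recip: "W * v = fps_recip u" if "K = u * v" "fps_nth u 0 = 1" for u v
  proof -
    have "(W * v) * (u * fps_recip u) = (W * K) * fps_recip u"
      unfolding that(1) by (simp only: mult_ac)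
    then show ?thesis
      by (simp add: fps_recip[OF that(2)] inverse)
  qed
  have W_mult_h: "W * h = ?g" and W_mult_g: "W * g = ?h"
    using recip[of g h] recip[of h g] factors neg_factor(1) nonneg_factor(1)
    by (simp_all add: mult.commute)
  have "W = W * (K - fps_X * fps_deriv K)"
    by (simp add: log_derivative)
  also have "\<dots> = 1 - fps_X * ((W * h) * fps_deriv g + (W * g) * fps_deriv h)"
    using inverse by (simp add: factors algebra_simps)
  finally have W_eq: "W = 1 - fps_X * (?g * fps_deriv g + ?h * fps_deriv h)"
    unfolding W_mult_h W_mult_g .
  have supp_recip: "supp_in {..0} ?g" "supp_in {0..} ?h"
    by (auto intro!: supp_in_fps_recip neg_factor nonneg_factor)
  have "xcoeff 0 (?g * fps_deriv g) = 0"
    by (subst xcoeff_0_mult)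
       (use supp_recip neg_factor supp_in_fps_deriv in \<open>auto simp: xcoeff_fps_deriv\<close>)
  moreover have "xcoeff 0 (?h * fps_deriv h) = xcoeff 0 ?h * fps_deriv (xcoeff 0 h)"
    by (subst xcoeff_0_mult)
       (use supp_recip nonneg_factor supp_in_fps_deriv in \<open>auto simp: xcoeff_fps_deriv\<close>)
  moreover have "xcoeff 0 (fps_X * u) = fps_X * xcoeff 0 u" for u :: "'a laurent fps"
    using xcoeff_lift_mult[of 0 fps_X u] by (simp add: fps_lift_fps_X)
  ultimately have "xcoeff 0 W = 1 - fps_X * (xcoeff 0 ?h * fps_deriv (xcoeff 0 h))"
    by (subst W_eq) (simp add: xcoeff_diff xcoeff_add xcoeff_1)
  then have "xcoeff 0 h * xcoeff 0 W =
      xcoeff 0 h - fps_X * ((xcoeff 0 h * xcoeff 0 ?h) * fps_deriv (xcoeff 0 h))"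
    by (simp only: right_diff_distrib mult_ac mult_1_left mult_1_right)
  moreover have "xcoeff 0 h * xcoeff 0 ?h = 1"
    using xcoeff_0_mult[of h ?h] supp_recip nonneg_factor by (simp add: fps_recip xcoeff_1)
  ultimately show ?thesis by simp
qed


subsection \<open>The bilateral series is algebraic\<close>

lemma is_algebraic_coeff_0_of_series_factor:
  fixes R :: "'a::idom poly poly"
  assumes product: "N * M = map_poly fps_of_poly R" and "R \<noteq> 0" "lead_coeff N = 1"
  shows "rf.is_algebraic (to_fract (coeff M 0))"
proof -
  define emb :: "'a poly fract \<Rightarrow> 'a fps fract alg_closure" where "emb r = to_ac (ratfun_embed r)"
    for r
  define \<iota> :: "'a fps \<Rightarrow> 'a fps fract alg_closure" where "\<iota> f = to_ac (to_fract f)" for f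
  interpret emb: field_embedding emb
    by unfold_locales (simp_all add: emb_def rf.hom_add rf.hom_mult)
  interpret \<iota>: comm_ring_hom \<iota>
    by unfold_locales (simp_all add: \<iota>_def)
  interpret ac: comm_ring_hom "to_ac :: 'a fps fract \<Rightarrow> _"
    by unfold_locales simp_all
  have "degree (map_poly \<iota> N) = degree N"
    using assms(3) by (intro degree_map_poly) (simp add: \<iota>_def)
  then have lead_N: "lead_coeff (map_poly \<iota> N) = 1"
    using assms(3) by (simp add: coeff_map_poly)
  have "map_poly to_fract R \<noteq> 0"
    using \<open>R \<noteq> 0\<close> by (simp add: map_poly_eq_0_iff)
  have "map_poly \<iota> N * map_poly \<iota> M = map_poly \<iota> (map_poly fps_of_poly R)"
    by (simp add: \<iota>.map_poly_hom_mult[symmetric] product)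
  also have "\<dots> = map_poly emb (map_poly to_fract R)"
    by (rule poly_eqI) (simp add: coeff_map_poly \<iota>_def emb_def to_fract_fps_of_poly)
  finally have "emb.is_algebraic (coeff (map_poly \<iota> M) 0)"
    using \<open>map_poly to_fract R \<noteq> 0\<close> lead_N
    by (rule is_algebraic_coeff_0_of_factor[OF emb.field_embedding_axioms])
  then obtain p where relation: "p \<noteq> 0" "poly (map_poly emb p) (to_ac (to_fract (coeff M 0))) = 0"
    by (auto simp: emb.is_algebraic_def coeff_map_poly \<iota>_def)
  have "map_poly emb p = map_poly to_ac (map_poly ratfun_embed p)"
    by (rule poly_eqI) (simp add: coeff_map_poly emb_def)
  then have "poly (map_poly ratfun_embed p) (to_fract (coeff M 0)) = 0"
    using relation(2) by (simp add: ac.hom_poly[symmetric])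
  with relation(1) show ?thesis
    unfolding rf.is_algebraic_def by blast
qed

definition nonneg_poly :: "nat \<Rightarrow> 'a::comm_ring_1 laurent fps \<Rightarrow> 'a fps poly" where
  "nonneg_poly d f = (\<Sum>i\<le>d. monom (xcoeff (int i) f) i)"

lemma coeff_nonneg_poly: "supp_in {..int d} f \<Longrightarrow> coeff (nonneg_poly d f) i = xcoeff (int i) f"
  by (auto simp: nonneg_poly_def coeff_sum supp_in_iff)

lemma nonneg_poly_mult:
  assumes "supp_in {0..int d} f" "supp_in {0..int e} g"
  shows "nonneg_poly (d + e) (f * g) = nonneg_poly d f * nonneg_poly e g"
proof (rule poly_eqI)
  fix n
  have supp_f: "supp_in {..int d} f" and supp_g: "supp_in {..int e} g"
    using assms by (auto elim: supp_in_mono)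
  have supp_product: "supp_in {..int (d + e)} (f * g)"
    by (rule supp_in_mult[OF supp_f supp_g]) auto
  have "xcoeff i f = 0 \<or> xcoeff (int n - i) g = 0" if "i \<notin> int ` {..n}" for i
  proof -
    have "i < 0 \<or> int n - i < 0"
      using that by (metis atMost_iff image_eqI int_nat_eq nat_le_iff not_le diff_less_0_iff_less)
    then show ?thesis
      using assms by (auto simp: supp_in_iff)
  qed
  then have "xcoeff (int n) (f * g) = (\<Sum>i\<in>int ` {..n}. xcoeff i f * xcoeff (int n - i) g)"
    by (intro xcoeff_mult) auto
  also have "\<dots> = (\<Sum>i\<le>n. xcoeff (int i) f * xcoeff (int (n - i)) g)"
    by (subst sum.reindex) (auto simp: of_nat_diff intro!: sum.cong)
  finally show "coeff (nonneg_poly (d + e) (f * g)) n = coeff (nonneg_poly d f * nonneg_poly e g) n"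
    by (simp add: coeff_nonneg_poly[OF supp_f] coeff_nonneg_poly[OF supp_g]
        coeff_nonneg_poly[OF supp_product] coeff_mult)
qed

lemma is_algebraic_xcoeff_0_of_factor:
  fixes g h :: "'a::idom laurent fps"
  assumes product: "g * h = fps_of_poly P" "P \<noteq> 0"
    and neg_factor: "supp_in {- int d..0} g" "xcoeff 0 g = 1" and supp_h: "supp_in {0..int d} h"
  shows "rf.is_algebraic (to_fract (xcoeff 0 h))"
proof -
  let ?g = "x_monom (int d) * g"
  let ?N = "nonneg_poly d ?g" and ?M = "nonneg_poly d h"
  have supp_g: "supp_in {0..int d} ?g"
    using neg_factor(1) by (auto simp: supp_in_iff xcoeff_x_monom_mult)
  have coeff_N: "coeff ?N i = xcoeff (int i - int d) g" for i
    using supp_in_mono[OF supp_g] by (subst coeff_nonneg_poly) (auto simp: xcoeff_x_monom_mult)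
  have coeff_M: "coeff ?M i = xcoeff (int i) h" for i
    using supp_in_mono[OF supp_h] by (subst coeff_nonneg_poly) auto
  define R where "R = (\<Sum>i\<le>d + d. monom (map_poly (\<lambda>c. Poly_Mapping.lookup c (int i - int d)) P) i)"
  have "?N * ?M = nonneg_poly (d + d) (x_monom (int d) * fps_of_poly P)"
    using nonneg_poly_mult[OF supp_g supp_h] by (simp add: mult.assoc product(1))
  also have "\<dots> = map_poly fps_of_poly R"
    by (rule poly_eqI)
       (simp add: nonneg_poly_def R_def coeff_sum coeff_map_poly xcoeff_x_monom_mult
         xcoeff_fps_of_poly)
  finally have poly_product: "?N * ?M = map_poly fps_of_poly R" .
  have "coeff ?N d = 1" "\<And>i. i > d \<Longrightarrow> coeff ?N i = 0"
    using neg_factor by (auto simp: coeff_N supp_in_iff)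
  then have "degree ?N = d"
    by (intro antisym degree_le le_degree) auto
  then have lead_N: "lead_coeff ?N = 1"
    using \<open>coeff ?N d = 1\<close> by simp
  have "h \<noteq> 0"
    using product fps_of_poly_nonzero[of P] by auto
  have "?M \<noteq> 0"
  proof
    assume "?M = 0"
    then have "xcoeff k h = 0" for k
      using coeff_M[of "nat k"] supp_h by (cases "k \<ge> 0") (auto simp: supp_in_iff)
    then have "h = 0" by (intro laurent_fps_eqI) simp
    with \<open>h \<noteq> 0\<close> show False ..
  qed
  then have "R \<noteq> 0"
    using poly_product lead_N by auto
  then have "rf.is_algebraic (to_fract (coeff ?M 0))"
    by (rule is_algebraic_coeff_0_of_series_factor[OF poly_product _ lead_N])
  then show ?thesis
    by (simp add: coeff_M)
qed

lemma walk_kernel_eq_poly: "walk_kernel \<SS> = fps_of_poly [:1, - step_poly \<SS>:]"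
  by (simp add: walk_kernel_eq fps_of_poly_pCons)

lemma finite_subset_int_interval:
  assumes "finite A"
  obtains d where "A \<subseteq> {- int d..int d}"
proof -
  obtain k where "\<And>a. a \<in> A \<Longrightarrow> \<bar>a\<bar> \<le> k"
    using assms by (auto simp: finite_int_iff_bounded_le)
  then have "A \<subseteq> {- int (nat k)..int (nat k)}" by force
  then show ?thesis by (rule that)
qed

lemma walk_kernel_supp:
  obtains d where "supp_in {- int d..int d} (walk_kernel \<SS>)"
proof -
  obtain d where "Poly_Mapping.keys (step_poly \<SS>) \<subseteq> {- int d..int d}"
    by (rule finite_subset_int_interval[OF finite_keys])
  then have "supp_in {- int d..int d} (fps_X * fps_const (step_poly \<SS>))"
    unfolding supp_in_def by auto
  then have "supp_in {- int d..int d} (walk_kernel \<SS>)"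
    unfolding walk_kernel_eq by (intro supp_in_diff supp_in_1) auto
  then show ?thesis using that by blast
qed

lemma bilateral_gf_in_rat_algebra:
  assumes "finite \<SS>"
  obtains G where "rat_algebra G" "gf_x (walks \<SS>) \<in> rat_span G"
proof -
  obtain d where supp_kernel: "supp_in {- int d..int d} (walk_kernel \<SS>)"
    by (rule walk_kernel_supp)
  obtain g h where factors: "walk_kernel \<SS> = g * h" "fps_nth g 0 = 1" "fps_nth h 0 = 1"
      "supp_in {- int d..0} g" "xcoeff 0 g = 1" "supp_in {0..int d} h"
    using wiener_hopf_factorization[OF walk_kernel_nth_0 supp_kernel] by blast
  define k where "k = xcoeff 0 h"
  have "rf.is_algebraic (to_fract k)"
    unfolding k_def
    by (rule is_algebraic_xcoeff_0_of_factor[where P = "[:1, - step_poly \<SS>:]"])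
       (use factors in \<open>simp_all add: walk_kernel_eq_poly\<close>)
  then obtain G where algebra: "rat_algebra G" "k \<in> rat_span G"
    by (rule is_algebraic_imp_rat_algebra)
  have "k * xcoeff 0 (gf_xy (walks \<SS>)) = k - fps_X * fps_deriv k"
    unfolding k_def
  proof (rule xcoeff_0_inverse_kernel[OF _ _ factors(1,2) _ factors(5,3)])
    show "gf_xy (walks \<SS>) * walk_kernel \<SS> = 1"
      by (rule gf_walks_mult_kernel[OF assms])
    show "walk_kernel \<SS> - fps_X * fps_deriv (walk_kernel \<SS>) = 1"
      by (simp add: walk_kernel_eq)
  qed (use factors(4,6) in \<open>auto elim: supp_in_mono\<close>)
  then have k_mult: "k * gf_x (walks \<SS>) = k - fps_of_poly [:0, 1:] * fps_deriv k"
    by (simp add: walks_eq_avoiding gf_x_avoiding[OF assms])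
  have "k * gf_x (walks \<SS>) \<in> rat_span G"
    unfolding k_mult
    by (intro rat_span_diff rat_span_poly_mult rat_algebra_derivation[OF algebra] algebra
        ratfun_derivation_if_partial partial_derivation_t)
  moreover have "k \<noteq> 0"
    using factors(3) by (auto simp: k_def fps_eq_iff intro!: exI[of _ 0])
  ultimately show ?thesis
    using that[OF algebra(1) rat_algebra_cancel[OF algebra]] by blast
qed

lemma D_finite_log_bilateral:
  assumes "finite \<SS>" "is_log (gf_x (walks \<SS>)) l"
  shows "D_finite xt_derivs l"
proof -
  obtain G where "rat_algebra G" "gf_x (walks \<SS>) \<in> rat_span G"
    using assms(1) by (rule bilateral_gf_in_rat_algebra)
  then show ?thesis
    by (rule D_finite_log[OF _ _ assms(2) partial_derivation_xt])
qed

lemma D_finite_log_walk_kernel: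
  assumes "is_log (walk_kernel \<SS>) l"
  shows "D_finite xyt_derivs l"
proof (rule D_finite_log[OF rat_algebra_singleton_1 _ assms partial_derivation_xyt])
  have "fps_of_poly [:1, - step_poly \<SS>:] * 1 \<in> rat_span {1}"
    by (intro rat_span_poly_mult rat_span_base) simp
  then show "walk_kernel \<SS> \<in> rat_span {1}"
    by (simp add: walk_kernel_eq_poly)
qed


subsection \<open>Bounded combinations\<close>

definition degree_bounded :: "nat \<Rightarrow> 'a::zero laurent fps \<Rightarrow> bool" where
  "degree_bounded d f \<longleftrightarrow> (\<forall>n>d. fps_nth f n = 0) \<and> supp_in {- int d..int d} f"

lemma degree_bounded_mono: "degree_bounded d f \<Longrightarrow> d \<le> e \<Longrightarrow> degree_bounded e f"
  unfolding degree_bounded_def by (auto intro: supp_in_mono)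

lemma degree_bounded_0: "degree_bounded d 0"
  by (simp add: degree_bounded_def supp_in_def)

lemma degree_bounded_1: "degree_bounded d (1 :: 'a::comm_ring_1 laurent fps)"
  by (auto simp: degree_bounded_def intro: supp_in_1)

lemma degree_bounded_add: "degree_bounded d f \<Longrightarrow> degree_bounded d g \<Longrightarrow> degree_bounded d (f + g)"
  by (auto simp: degree_bounded_def intro: supp_in_add)

lemma degree_bounded_mult:
  fixes f g :: "'a::comm_ring_1 laurent fps"
  assumes "degree_bounded d f" "degree_bounded e g"
  shows "degree_bounded (d + e) (f * g)"
  unfolding degree_bounded_def
proof (intro conjI allI impI)
  fix n assume n_large: "n > d + e"
  have "fps_nth f i * fps_nth g (n - i) = 0" for i
    by (cases "i > d") (use assms n_large in \<open>auto simp: degree_bounded_def\<close>)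
  then show "fps_nth (f * g) n = 0"
    unfolding fps_mult_nth by (intro sum.neutral) blast
next
  show "supp_in {- int (d + e)..int (d + e)} (f * g)"
    by (rule supp_in_mult[of "{- int d..int d}" _ "{- int e..int e}"])
       (use assms in \<open>auto simp: degree_bounded_def\<close>)
qed

lemma degree_bounded_power: "degree_bounded d f \<Longrightarrow> degree_bounded (n * d) (f ^ n)"
  for f :: "'a::comm_ring_1 laurent fps"
  by (induction n) (auto simp: degree_bounded_1 intro: degree_bounded_mult)

lemma degree_bounded_of_nat: "degree_bounded 0 (of_nat n :: 'a::comm_ring_1 laurent fps)"
  by (induction n) (auto simp: degree_bounded_0 degree_bounded_1 intro: degree_bounded_add)

lemma degree_bounded_fps_X_power: "degree_bounded i (fps_X ^ i :: 'a::comm_ring_1 laurent fps)"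
  by (auto simp: degree_bounded_def supp_in_def fps_X_power_iff)

lemma degree_bounded_x_monom: "degree_bounded (nat \<bar>k\<bar>) (x_monom k)"
  by (auto simp: degree_bounded_def supp_in_def x_monom_def)

lemma degree_bounded_derivative:
  fixes f :: "'a::idom laurent fps"
  assumes "\<delta> \<in> xt_derivs" "degree_bounded d f"
  shows "degree_bounded (d + 1) (\<delta> f)"
proof -
  have "degree_bounded d (fps_deriv f)"
    using assms(2) by (auto simp: degree_bounded_def intro: supp_in_fps_deriv)
  moreover have "degree_bounded (d + 1) (x_deriv f)"
    using assms(2) unfolding degree_bounded_def supp_in_iff xcoeff_x_deriv
    by (auto simp: derivation.zero[OF derivation_laurent_deriv])
  ultimately show ?thesis
    using assms(1) degree_bounded_mono[of d "fps_deriv f" "d + 1"] by auto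
qed

lemma degree_bounded_fps_of_poly: "\<exists>d. degree_bounded d (fps_of_poly p)"
proof -
  have "finite (\<Union>n\<le>degree p. Poly_Mapping.keys (coeff p n))"
    by simp
  then obtain d where keys_bound: "(\<Union>n\<le>degree p. Poly_Mapping.keys (coeff p n)) \<subseteq> {- int d..int d}"
    by (rule finite_subset_int_interval)
  have "Poly_Mapping.keys (coeff p n) \<subseteq> {- int d..int d}" for n
    by (cases "n \<le> degree p") (use keys_bound in \<open>auto simp: coeff_eq_0\<close>)
  then have "degree_bounded (degree p + d) (fps_of_poly p)"
    by (fastforce simp: degree_bounded_def supp_in_def coeff_eq_0)
  then show ?thesis ..
qed

lemma degree_bounded_imp_poly:
  fixes f :: "'a::comm_ring_1 laurent fps"
  assumes "degree_bounded d f"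
  obtains p where "f = fps_of_poly p"
proof
  have "coeff (\<Sum>n\<le>d. monom (fps_nth f n) n) n = fps_nth f n" for n
    using assms by (auto simp: coeff_sum degree_bounded_def)
  then show "f = fps_of_poly (\<Sum>n\<le>d. monom (fps_nth f n) n)"
    by (simp add: fps_eq_iff)
qed

definition bounded_span :: "'a::comm_ring_1 laurent fps set \<Rightarrow> nat \<Rightarrow> 'a laurent fps \<Rightarrow> bool" where
  "bounded_span G d f \<longleftrightarrow> (\<exists>p. (\<forall>g\<in>G. degree_bounded d (p g)) \<and> f = (\<Sum>g\<in>G. p g * g))"

lemma bounded_span_mono: "bounded_span G d f \<Longrightarrow> d \<le> e \<Longrightarrow> bounded_span G e f"
  unfolding bounded_span_def using degree_bounded_mono by blast

lemma bounded_span_0: "bounded_span G d 0"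
  unfolding bounded_span_def by (intro exI[of _ "\<lambda>_. 0"]) (simp add: degree_bounded_0)

lemma bounded_span_add:
  assumes "bounded_span G d f" "bounded_span G d g"
  shows "bounded_span G d (f + g)"
proof -
  from assms obtain p r where
    "\<forall>h\<in>G. degree_bounded d (p h)" "f = (\<Sum>h\<in>G. p h * h)"
    "\<forall>h\<in>G. degree_bounded d (r h)" "g = (\<Sum>h\<in>G. r h * h)"
    unfolding bounded_span_def by blast
  then show ?thesis
    unfolding bounded_span_def
    by (intro exI[of _ "\<lambda>h. p h + r h"]) (simp add: degree_bounded_add sum.distrib distrib_right)
qed

lemma bounded_span_sum: "(\<And>i. i \<in> I \<Longrightarrow> bounded_span G d (f i)) \<Longrightarrow> bounded_span G d (sum f I)"
  by (induction I rule: infinite_finite_induct) (simp_all add: bounded_span_0 bounded_span_add)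

lemma bounded_span_mult:
  assumes "degree_bounded c u" "bounded_span G d f"
  shows "bounded_span G (c + d) (u * f)"
proof -
  from assms(2) obtain p where "\<forall>h\<in>G. degree_bounded d (p h)" "f = (\<Sum>h\<in>G. p h * h)"
    unfolding bounded_span_def by blast
  then show ?thesis
    unfolding bounded_span_def using assms(1)
    by (intro exI[of _ "\<lambda>h. u * p h"]) (simp add: degree_bounded_mult sum_distrib_left mult.assoc)
qed

lemma bounded_span_diff:
  assumes "bounded_span G d f" "bounded_span G d g"
  shows "bounded_span G d (f - g)"
proof -
  have "degree_bounded 0 (- 1 :: 'a laurent fps)"
    by (simp add: degree_bounded_def supp_in_def)
  then have "bounded_span G d (f + - 1 * g)"
    using bounded_span_mult[of 0 "- 1" G d g] assms by (intro bounded_span_add) auto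
  then show ?thesis by simp
qed

lemma bounded_span_base:
  assumes "finite G" "e \<in> G" "degree_bounded d u"
  shows "bounded_span G d (u * e)"
  unfolding bounded_span_def
proof (intro exI[of _ "\<lambda>h. if h = e then u else 0"] conjI)
  have "(\<Sum>h\<in>G. (if h = e then u else 0) * h) = (\<Sum>h\<in>G. if h = e then u * e else 0)"
    by (intro sum.cong) auto
  then show "u * e = (\<Sum>h\<in>G. (if h = e then u else 0) * h)"
    using assms by simp
qed (use assms degree_bounded_0 in auto)

locale bounded_derivs =
  fixes G :: "'a::idom laurent fps set" and q :: "'a laurent fps" and D :: nat
  assumes finite_G: "finite G" and q_nonzero: "q \<noteq> 0" and q_bounded: "degree_bounded D q"
    and derivs_bounded: "\<delta> \<in> xt_derivs \<Longrightarrow> g \<in> G \<Longrightarrow> bounded_span G D (q * \<delta> g)"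

lemma deriv_closed_bounded_derivs:
  assumes "deriv_closed xt_derivs G"
  obtains q D where "bounded_derivs G q D"
proof -
  let ?F = "fps_deriv ` G \<union> x_deriv ` G"
  have finite: "finite G" "finite ?F" and "?F \<subseteq> rat_span G"
    using assms by (auto simp: deriv_closed_def)
  obtain q p where q_nonzero: "q \<noteq> 0"
    and relation: "\<And>f. f \<in> ?F \<Longrightarrow> fps_of_poly q * f = (\<Sum>g\<in>G. fps_of_poly (p f g) * g)"
    using rat_span_common_denominator[OF finite(2,1) \<open>?F \<subseteq> rat_span G\<close>] by blast
  obtain d where degree_bound: "\<And>r. degree_bounded (d r) (fps_of_poly r :: 'a laurent fps)"
    using degree_bounded_fps_of_poly by metis
  let ?S = "insert q ((\<lambda>(f, g). p f g) ` (?F \<times> G))"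
  have bounded: "degree_bounded (sum d ?S) (fps_of_poly r)" if "r \<in> ?S" for r
    using member_le_sum[OF that, of d] finite by (intro degree_bounded_mono[OF degree_bound]) auto
  have "bounded_span G (sum d ?S) (fps_of_poly q * f)" if "f \<in> ?F" for f
    unfolding bounded_span_def relation[OF that]
    by (intro exI[of _ "\<lambda>g. fps_of_poly (p f g)"] conjI ballI bounded refl) (use that in auto)
  then have "bounded_derivs G (fps_of_poly q) (sum d ?S)"
    using finite(1) q_nonzero bounded[of q] by unfold_locales (auto simp: fps_of_poly_nonzero)
  then show ?thesis by (rule that)
qed

abbreviation mixed_deriv :: "nat \<Rightarrow> nat \<Rightarrow> 'a::comm_ring_1 laurent fps \<Rightarrow> 'a laurent fps" where
  "mixed_deriv j l f \<equiv> (fps_deriv ^^ j) ((x_deriv ^^ l) f)"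

context bounded_derivs
begin

lemma bounded_span_derivative:
  assumes xt: "\<delta> \<in> xt_derivs" and "bounded_span G d f"
  shows "bounded_span G (d + (D + 1)) (q * \<delta> f)"
proof -
  interpret derivation \<delta>
    using xt by (intro derivation_if_partial partial_derivation_xt)
  obtain p where combination: "\<And>h. h \<in> G \<Longrightarrow> degree_bounded d (p h)" "f = (\<Sum>h\<in>G. p h * h)"
    using assms(2) unfolding bounded_span_def by blast
  have "q * \<delta> f = (\<Sum>h\<in>G. (q * \<delta> (p h)) * h + p h * (q * \<delta> h))"
    unfolding combination(2) sum mult sum_distrib_left
    by (intro sum.cong) (simp_all add: algebra_simps)
  also have "bounded_span G (d + (D + 1)) \<dots>"
  proof (intro bounded_span_sum bounded_span_add)
    fix h assume h_in_G: "h \<in> G"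
    have "degree_bounded (D + (d + 1)) (q * \<delta> (p h))"
      by (intro degree_bounded_mult degree_bounded_derivative q_bounded xt combination(1) h_in_G)
    then have "degree_bounded (d + (D + 1)) (q * \<delta> (p h))"
      by (simp add: add_ac)
    then show "bounded_span G (d + (D + 1)) (q * \<delta> (p h) * h)"
      by (rule bounded_span_base[OF finite_G h_in_G])
    show "bounded_span G (d + (D + 1)) (p h * (q * \<delta> h))"
      using bounded_span_mult[OF combination(1)[OF h_in_G] derivs_bounded[OF xt h_in_G]]
      by (rule bounded_span_mono) simp
  qed
  finally show ?thesis .
qed

lemma bounded_span_power_derivative:
  assumes xt: "\<delta> \<in> xt_derivs" and bounded_f: "bounded_span G d (q ^ j * f)"
  shows "bounded_span G (d + (D + 1)) (q ^ Suc j * \<delta> f)"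
proof -
  interpret derivation \<delta>
    using xt by (intro derivation_if_partial partial_derivation_xt)
  have "q * \<delta> (q ^ j) = of_nat j * \<delta> q * q ^ j"
    by (cases j) (simp_all add: power mult_ac del: power_Suc of_nat_Suc, simp add: mult_ac)
  then have "q ^ Suc j * \<delta> f = q * \<delta> (q ^ j * f) - (of_nat j * \<delta> q) * (q ^ j * f)"
    by (simp add: mult distrib_left mult.assoc[symmetric])
  moreover have "bounded_span G (d + (D + 1)) ((of_nat j * \<delta> q) * (q ^ j * f))"
    using bounded_span_mult[OF degree_bounded_mult[OF degree_bounded_of_nat
        degree_bounded_derivative[OF xt q_bounded]] bounded_f]
    by (simp add: add_ac)
  ultimately show ?thesis
    using bounded_span_diff[OF bounded_span_derivative[OF xt bounded_f]] by simp
qed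

lemma bounded_span_mixed_deriv:
  assumes "bounded_span G s f"
  shows "bounded_span G (s + (j + l) * (D + 1)) (q ^ (j + l) * mixed_deriv j l f)"
proof (induction j)
  case 0
  show ?case
  proof (induction l)
    case (Suc l)
    have "bounded_span G (s + l * (D + 1) + (D + 1)) (q ^ Suc l * x_deriv ((x_deriv ^^ l) f))"
      by (rule bounded_span_power_derivative) (use Suc in simp_all)
    then show ?case by (simp add: add_ac)
  qed (simp add: assms)
next
  case (Suc j)
  have "bounded_span G (s + (j + l) * (D + 1) + (D + 1))
      (q ^ Suc (j + l) * fps_deriv (mixed_deriv j l f))"
    by (rule bounded_span_power_derivative) (use Suc in simp_all)
  then show ?case by (simp add: add_ac)
qed

lemma bounded_span_monomial_mixed_deriv:
  assumes "bounded_span G s f" "i < N" "j < N" "l < N"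
  shows "bounded_span G (4 * N * (D + 1 + s)) (q ^ (2 * N) * (fps_X ^ i * mixed_deriv j l f))"
proof -
  have "q ^ (2 * N) = q ^ (2 * N - (j + l)) * q ^ (j + l)"
    using assms by (simp add: power_add[symmetric])
  then have "q ^ (2 * N) * (fps_X ^ i * mixed_deriv j l f) =
      (fps_X ^ i * q ^ (2 * N - (j + l))) * (q ^ (j + l) * mixed_deriv j l f)"
    by (simp add: mult_ac)
  also have "bounded_span G (i + (2 * N - (j + l)) * D + (s + (j + l) * (D + 1))) \<dots>"
    by (intro bounded_span_mult bounded_span_mixed_deriv assms degree_bounded_mult
        degree_bounded_fps_X_power degree_bounded_power q_bounded)
  finally show ?thesis
  proof (rule bounded_span_mono)
    have "(2 * N - (j + l)) * D \<le> (2 * N - (j + l)) * (D + 1)" by simp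
    moreover have "(2 * N - (j + l)) * (D + 1) + (j + l) * (D + 1) = 2 * N * (D + 1)"
      using assms by (simp add: add_mult_distrib[symmetric])
    moreover have "s \<le> N * s" using assms(2) by simp
    moreover have "N \<le> N * (D + 1)" by simp
    moreover have "4 * N * (D + 1 + s) = 4 * (N * (D + 1)) + 4 * (N * s)"
      by (simp add: algebra_simps)
    ultimately show "i + (2 * N - (j + l)) * D + (s + (j + l) * (D + 1)) \<le> 4 * N * (D + 1 + s)"
      using assms(2) by linarith
  qed
qed

end


subsection \<open>Coefficients of D-finite series\<close>

lemma degree_bounded_combination_eq_0:
  fixes c :: "'i \<Rightarrow> 'a::comm_ring_1" and u :: "'i \<Rightarrow> 'a laurent fps"
  assumes bounded: "\<And>i. i \<in> I \<Longrightarrow> degree_bounded d (u i)"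
    and zero: "\<And>n v. n \<le> d \<Longrightarrow> v \<in> {- int d..int d} \<Longrightarrow> (\<Sum>i\<in>I. c i * fps_nth (xcoeff v (u i)) n) = 0"
  shows "(\<Sum>i\<in>I. fps_lift (fps_const (c i)) * u i) = 0"
proof (intro laurent_fps_eqI fps_ext)
  fix v n
  have "(\<Sum>i\<in>I. c i * fps_nth (xcoeff v (u i)) n) = 0"
  proof (cases "n \<le> d \<and> v \<in> {- int d..int d}")
    case True
    then show ?thesis using zero by blast
  next
    case False
    have "fps_nth (xcoeff v (u i)) n = 0" if "i \<in> I" for i
      using bounded[OF that] False unfolding degree_bounded_def supp_in_iff
      by (cases "n \<le> d") (simp_all add: fps_eq_iff)
    then show ?thesis by simp
  qed
  then show "fps_nth (xcoeff v (\<Sum>i\<in>I. fps_lift (fps_const (c i)) * u i)) n = fps_nth (xcoeff v 0) n"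
    by (simp only: xcoeff_sum xcoeff_lift_mult fps_sum_nth fps_mult_left_const_nth xcoeff_0
        fps_zero_nth)
qed

lemma bounded_span_dependent:
  fixes m :: "'i \<Rightarrow> 'a::field laurent fps"
  assumes "finite G" "finite I" "q \<noteq> 0" and bounded: "\<And>\<alpha>. \<alpha> \<in> I \<Longrightarrow> bounded_span G d (q * m \<alpha>)"
    and card: "card G * ((d + 1) * (2 * d + 1)) < card I"
  obtains c where "\<exists>\<alpha>\<in>I. c \<alpha> \<noteq> 0" "(\<Sum>\<alpha>\<in>I. fps_lift (fps_const (c \<alpha>)) * m \<alpha>) = 0"
proof -
  have "\<forall>\<alpha>\<in>I. \<exists>p. (\<forall>g\<in>G. degree_bounded d (p g)) \<and> q * m \<alpha> = (\<Sum>g\<in>G. p g * g)"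
    using bounded unfolding bounded_span_def by blast
  from bchoice[OF this] obtain p where
    combination: "\<And>\<alpha> g. \<alpha> \<in> I \<Longrightarrow> g \<in> G \<Longrightarrow> degree_bounded d (p \<alpha> g)"
      "\<And>\<alpha>. \<alpha> \<in> I \<Longrightarrow> q * m \<alpha> = (\<Sum>g\<in>G. p \<alpha> g * g)"
    by blast
  let ?J = "G \<times> {..d} \<times> {- int d..int d}"
  have "card ?J < card I"
    using card by (simp add: card_cartesian_product nat_add_distrib nat_mult_distrib)
  then obtain c where nonzero: "\<exists>\<alpha>\<in>I. c \<alpha> \<noteq> 0"
    and system: "\<And>\<beta>. \<beta> \<in> ?J \<Longrightarrow>
      (\<Sum>\<alpha>\<in>I. c \<alpha> * (case \<beta> of (g, n, v) \<Rightarrow> fps_nth (xcoeff v (p \<alpha> g)) n)) = 0"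
    using assms(1,2)
      homogeneous_system_nontrivial[of I ?J "\<lambda>\<alpha> (g, n, v). fps_nth (xcoeff v (p \<alpha> g)) n"]
    by auto
  let ?c = "\<lambda>\<alpha>. fps_lift (fps_const (c \<alpha>))"
  have combination_0: "(\<Sum>\<alpha>\<in>I. ?c \<alpha> * p \<alpha> g) = 0" if "g \<in> G" for g
    using combination(1)[OF _ that] system[of "(g, _, _)"] that
    by (intro degree_bounded_combination_eq_0[of I d]) auto
  have "q * (\<Sum>\<alpha>\<in>I. ?c \<alpha> * m \<alpha>) = (\<Sum>\<alpha>\<in>I. ?c \<alpha> * (q * m \<alpha>))"
    by (simp add: sum_distrib_left mult_ac)
  also have "\<dots> = (\<Sum>\<alpha>\<in>I. \<Sum>g\<in>G. ?c \<alpha> * p \<alpha> g * g)"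
    by (intro sum.cong) (simp_all add: combination(2) sum_distrib_left mult.assoc)
  also have "\<dots> = (\<Sum>g\<in>G. (\<Sum>\<alpha>\<in>I. ?c \<alpha> * p \<alpha> g) * g)"
    by (subst sum.swap) (simp only: sum_distrib_right)
  also have "\<dots> = 0"
    by (simp add: combination_0)
  finally show ?thesis
    using \<open>q \<noteq> 0\<close> nonzero that by simp
qed

lemma quadratic_count_less_cube:
  fixes k m :: nat
  assumes "N = 45 * k * m\<^sup>2 + 1" "m \<ge> 1"
  shows "k * ((4 * N * m + 1) * (2 * (4 * N * m) + 1)) < N * (N * N)"
proof -
  have "1 \<le> N * m" using assms by simp
  then have "4 * N * m + 1 \<le> 5 * (N * m)" "2 * (4 * N * m) + 1 \<le> 9 * (N * m)"
    by simp_all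
  then have "(4 * N * m + 1) * (2 * (4 * N * m) + 1) \<le> (5 * (N * m)) * (9 * (N * m))"
    by (rule mult_le_mono)
  then have "k * ((4 * N * m + 1) * (2 * (4 * N * m) + 1)) \<le> k * ((5 * (N * m)) * (9 * (N * m)))"
    by (rule mult_le_mono2)
  also have "\<dots> = N * (N * (45 * k * m\<^sup>2))"
    by (simp add: power2_eq_square algebra_simps)
  also have "\<dots> < N * (N * N)"
    using assms by (intro mult_strict_left_mono) simp_all
  finally show ?thesis .
qed

text \<open>
  Lipshitz' argument. The elements \<open>t^i \<partial>\<^sub>t^j \<partial>\<^sub>x^l f\<close> with \<open>i, j, l < N\<close> number \<open>N^3\<close>, but after
  multiplication by a fixed polynomial they lie in a vector space of dimension \<open>O(N^2)\<close>. This
  yields a nonzero differential operator without \<open>x\<close> that annihilates \<open>f\<close>.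
\<close>

lemma lipshitz_relation:
  fixes f :: "'a::field laurent fps"
  assumes "bounded_derivs G q D" "bounded_span G s f"
  obtains N P where "\<exists>l<N. \<exists>j<N. P l j \<noteq> 0"
    "(\<Sum>l<N. \<Sum>j<N. fps_lift (fps_of_poly (P l j)) * mixed_deriv j l f) = 0"
proof -
  interpret bounded_derivs G q D by fact
  define N where "N = 45 * card G * (D + 1 + s)\<^sup>2 + 1"
  define I where "I = {..<N} \<times> {..<N} \<times> {..<N}"
  define m where "m = (\<lambda>(l, j, i). fps_X ^ i * mixed_deriv j l f)"
  have "card G * ((4 * N * (D + 1 + s) + 1) * (2 * (4 * N * (D + 1 + s)) + 1)) < card I"
    using quadratic_count_less_cube[OF N_def] by (simp add: I_def card_cartesian_product)
  moreover have "bounded_span G (4 * N * (D + 1 + s)) (q ^ (2 * N) * m \<alpha>)" if "\<alpha> \<in> I" for \<alpha>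
    using that bounded_span_monomial_mixed_deriv[OF assms(2)] by (auto simp: I_def m_def)
  ultimately obtain c where relation: "\<exists>\<alpha>\<in>I. c \<alpha> \<noteq> 0"
      "(\<Sum>\<alpha>\<in>I. fps_lift (fps_const (c \<alpha>)) * m \<alpha>) = 0"
    using finite_G q_nonzero
    by (elim bounded_span_dependent[of G I "q ^ (2 * N)", rotated 3]) (auto simp: I_def)
  define P where "P l j = (\<Sum>i<N. monom (c (l, j, i)) i)" for l j
  have lift_P: "fps_lift (fps_of_poly (P l j)) =
      (\<Sum>i<N. fps_lift (fps_const (c (l, j, i))) * fps_X ^ i)"
    for l j
    by (simp add: P_def fps_of_poly_sum fps_of_poly_monom fps_lift.hom_sum fps_lift.hom_mult
        fps_lift.hom_power fps_lift_fps_X)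
  have "(\<Sum>l<N. \<Sum>j<N. fps_lift (fps_of_poly (P l j)) * mixed_deriv j l f) =
      (\<Sum>\<alpha>\<in>I. fps_lift (fps_const (c \<alpha>)) * m \<alpha>)"
    unfolding I_def m_def lift_P sum_distrib_right mult.assoc
    by (simp add: sum.cartesian_product case_prod_beta')
  then have "(\<Sum>l<N. \<Sum>j<N. fps_lift (fps_of_poly (P l j)) * mixed_deriv j l f) = 0"
    using relation(2) by simp
  moreover have "\<exists>l<N. \<exists>j<N. P l j \<noteq> 0"
  proof -
    obtain l j i where nonzero: "l < N" "j < N" "i < N" "c (l, j, i) \<noteq> 0"
      using relation(1) by (auto simp: I_def)
    then have "coeff (P l j) i \<noteq> 0"
      by (simp add: P_def coeff_sum)
    then have "P l j \<noteq> 0" by auto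
    with nonzero show ?thesis by blast
  qed
  ultimately show ?thesis
    using that[of N P] by blast
qed

lemma xcoeff_funpow_fps_deriv: "xcoeff k ((fps_deriv ^^ j) f) = (fps_deriv ^^ j) (xcoeff k f)"
  for f :: "'a::comm_ring_1 laurent fps"
  by (induction j) (simp_all add: xcoeff_fps_deriv)

lemma xcoeff_funpow_x_deriv:
  fixes f :: "'a::comm_ring_1 laurent fps"
  shows "xcoeff k ((x_deriv ^^ l) f) =
      fps_const (pochhammer (of_int (k + 1)) l) * xcoeff (k + int l) f"
proof (induction l arbitrary: k)
  case (Suc l)
  have "xcoeff k ((x_deriv ^^ Suc l) f) =
      fps_const (of_int (k + 1) * pochhammer (of_int (k + 1 + 1)) l) * xcoeff (k + 1 + int l) f"
    by (simp only: funpow.simps o_def xcoeff_x_deriv Suc[of "k + 1"] mult.assoc[symmetric]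
        fps_const_mult)
  also have "of_int (k + 1) * pochhammer (of_int (k + 1 + 1)) l =
      pochhammer (of_int (k + 1) :: 'a) (Suc l)"
    by (simp only: pochhammer_rec of_int_add of_int_1)
  also have "k + 1 + int l = k + int (Suc l)" by simp
  finally show ?case .
qed simp

lemma funpow_fps_deriv_const_mult:
  "(fps_deriv ^^ j) (fps_const c * f) = fps_const c * (fps_deriv ^^ j) f"
    for f :: "'a::comm_ring_1 fps"
  by (induction j) simp_all

lemma xcoeff_mixed_deriv:
  "xcoeff k (mixed_deriv j l f) =
    fps_const (pochhammer (of_int (k + 1)) l) * (fps_deriv ^^ j) (xcoeff (k + int l) f)"
  by (simp only: xcoeff_funpow_fps_deriv xcoeff_funpow_x_deriv funpow_fps_deriv_const_mult)

lemma ode_imp_D_finite: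
  fixes g :: "'a::idom fps"
  assumes "\<exists>j<N. P j \<noteq> 0" "(\<Sum>j<N. fps_of_poly (P j) * (fps_deriv ^^ j) g) = 0"
  shows "D_finite {fps_deriv} g"
proof -
  let ?J = "{j. j < N \<and> P j \<noteq> 0}"
  define r where "r = Max ?J"
  have "finite ?J" "?J \<noteq> {}"
    using assms(1) by auto
  then have order: "r < N" "P r \<noteq> 0" and above: "\<And>j. j < N \<Longrightarrow> P j \<noteq> 0 \<Longrightarrow> j \<le> r"
    using Max_in[of ?J] Max_ge[of ?J] by (auto simp: r_def)
  have "(\<Sum>j<N. fps_of_poly (P j) * (fps_deriv ^^ j) g) =
      (\<Sum>j<Suc r. fps_of_poly (P j) * (fps_deriv ^^ j) g)"
    by (rule sum.mono_neutral_right) (use order above in \<open>force simp: not_less_eq\<close>)+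
  then have leading: "fps_of_poly (P r) * (fps_deriv ^^ r) g =
      - (\<Sum>j<r. fps_of_poly (P j) * (fps_deriv ^^ j) g)"
    using assms(2) by (simp add: eq_neg_iff_add_eq_0 add.commute)
  define G where "G = (\<lambda>j. (fps_deriv ^^ j) g) ` {..<r}"
  have lower: "(fps_deriv ^^ j) g \<in> rat_span G" if "j < r" for j
    by (rule rat_span_base) (use that in \<open>auto simp: G_def\<close>)
  have "fps_of_poly (P r) * (fps_deriv ^^ r) g \<in> rat_span G"
    unfolding leading by (intro rat_span_uminus rat_span_sum rat_span_poly_mult lower) simp
  then have "(fps_deriv ^^ r) g \<in> rat_span G"
    by (rule rat_span_cancel_poly[OF order(2)])
  then have upto: "(fps_deriv ^^ j) g \<in> rat_span G" if "j \<le> r" for j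
    using lower[of j] that by (cases "j = r") auto
  show ?thesis
  proof (rule D_finiteI)
    show "deriv_closed {fps_deriv} G"
      using upto[of "Suc _"] by (auto simp: deriv_closed_def G_def)
    show "g \<in> rat_span G"
      using upto[of 0] by simp
  qed (auto intro: ratfun_derivation_if_partial partial_derivation_t)
qed

text \<open>
  Let \<open>a\<close> be the least order in \<open>\<partial>\<^sub>x\<close> that occurs in the annihilating operator. Since \<open>\<partial>\<^sub>x^l\<close> never
  produces \<open>x^(-1-a)\<close> for \<open>l > a\<close>, extracting that coefficient leaves an ordinary differential
  equation in \<open>t\<close>.
\<close>

lemma ode_of_x_free_relation:
  fixes f :: "'a::field_char_0 laurent fps"
  assumes nonzero: "\<exists>l<N. \<exists>j<N. P l j \<noteq> 0"
    and relation: "(\<Sum>l<N. \<Sum>j<N. fps_lift (fps_of_poly (P l j)) * mixed_deriv j l f) = 0"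
  obtains a where "\<exists>j<N. P a j \<noteq> 0"
    "(\<Sum>j<N. fps_of_poly (P a j) * (fps_deriv ^^ j) (xcoeff (- 1) f)) = 0"
proof -
  define a where "a = (LEAST l. l < N \<and> (\<exists>j<N. P l j \<noteq> 0))"
  have least: "a < N" "\<exists>j<N. P a j \<noteq> 0"
    using LeastI_ex[of "\<lambda>l. l < N \<and> (\<exists>j<N. P l j \<noteq> 0)"] nonzero unfolding a_def by blast+
  have below: "P l j = 0" if "l < a" "j < N" for l j
    using not_less_Least[of l "\<lambda>l. l < N \<and> (\<exists>j<N. P l j \<noteq> 0)"] that least(1) unfolding a_def
    by fastforce
  let ?w = "\<lambda>l. fps_const (pochhammer (- of_nat a :: 'a) l)"
  let ?S = "\<lambda>l. \<Sum>j<N. fps_of_poly (P l j) *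
    (?w l * (fps_deriv ^^ j) (xcoeff (- 1 - int a + int l) f))"
  have "?S l = 0" if "l \<noteq> a" for l
  proof (cases "l < a")
    case False
    with that have "?w l = 0"
      using pochhammer_of_nat_eq_0_iff[of a l, where 'a = 'a] by simp
    then show ?thesis by simp
  qed (simp add: below)
  then have "?S a = (\<Sum>l<N. ?S l)"
    using sum.remove[of "{..<N}" a ?S] least(1) by simp
  also have "\<dots> =
      xcoeff (- 1 - int a) (\<Sum>l<N. \<Sum>j<N. fps_lift (fps_of_poly (P l j)) * mixed_deriv j l f)"
    by (simp add: xcoeff_sum xcoeff_lift_mult xcoeff_mixed_deriv)
  also have "\<dots> = 0"
    by (simp only: relation xcoeff_0)
  finally have "?w a * (\<Sum>j<N. fps_of_poly (P a j) * (fps_deriv ^^ j) (xcoeff (- 1) f)) = 0"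
    by (simp add: sum_distrib_left mult.left_commute)
  moreover have "?w a \<noteq> 0"
    using pochhammer_of_nat_eq_0_iff[of a a, where 'a = 'a] by simp
  ultimately show ?thesis
    using that least(2) by simp
qed

lemma D_finite_xcoeff:
  fixes f :: "'a::field_char_0 laurent fps"
  assumes "D_finite xt_derivs f"
  shows "D_finite {fps_deriv} (xcoeff k f)"
proof -
  obtain G where closed: "deriv_closed xt_derivs G" "f \<in> G"
    using assms by (rule D_finiteE)
  obtain q D where bounded: "bounded_derivs G q D"
    using closed(1) by (rule deriv_closed_bounded_derivs)
  let ?f = "x_monom (- 1 - k) * f"
  have "bounded_span G (nat \<bar>- 1 - k\<bar>) ?f"
    using bounded_derivs.finite_G[OF bounded] closed(2) degree_bounded_x_monom
    by (rule bounded_span_base)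
  then obtain N P where "\<exists>l<N. \<exists>j<N. P l j \<noteq> 0"
      "(\<Sum>l<N. \<Sum>j<N. fps_lift (fps_of_poly (P l j)) * mixed_deriv j l ?f) = 0"
    by (rule lipshitz_relation[OF bounded])
  then obtain a where "\<exists>j<N. P a j \<noteq> 0"
      "(\<Sum>j<N. fps_of_poly (P a j) * (fps_deriv ^^ j) (xcoeff (- 1) ?f)) = 0"
    by (rule ode_of_x_free_relation)
  then show ?thesis
    by (intro ode_imp_D_finite) (simp_all add: xcoeff_x_monom_mult)
qed


subsection \<open>Nonnegative parts\<close>

definition nonneg_part :: "'a::comm_ring_1 laurent fps \<Rightarrow> 'a laurent fps" where
  "nonneg_part = fps_map (restrict_keys {0..})"

lemma xcoeff_nonneg_part: "xcoeff k (nonneg_part f) = (if k \<ge> 0 then xcoeff k f else 0)"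
  by (simp add: fps_eq_iff nonneg_part_def lookup_restrict_keys)

lemma nonneg_part_add: "nonneg_part (f + g) = nonneg_part f + nonneg_part g"
  by (rule laurent_fps_eqI) (simp add: xcoeff_nonneg_part xcoeff_add)

lemma nonneg_part_sum: "nonneg_part (sum f A) = (\<Sum>i\<in>A. nonneg_part (f i))"
  by (rule laurent_fps_eqI) (simp add: xcoeff_nonneg_part xcoeff_sum)

lemma nonneg_part_mult_lift: "nonneg_part (f * fps_lift c) = nonneg_part f * fps_lift c"
  by (rule laurent_fps_eqI)
     (simp add: xcoeff_nonneg_part mult.commute[of _ "fps_lift c"] xcoeff_lift_mult)

text \<open>The derivative with respect to \<open>x\<close> commutes because it annihilates \<open>x\<^sup>0\<close>.\<close>

lemma nonneg_part_deriv:
  fixes f :: "'a::idom laurent fps"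
  assumes "\<delta> \<in> xt_derivs"
  shows "nonneg_part (\<delta> f) = \<delta> (nonneg_part f)"
proof (rule laurent_fps_eqI)
  fix k :: int
  have "k = - 1 \<or> (0 \<le> k + 1) = (0 \<le> k)" by linarith
  then show "xcoeff k (nonneg_part (\<delta> f)) = xcoeff k (\<delta> (nonneg_part f))"
    using assms by (auto simp: xcoeff_nonneg_part xcoeff_fps_deriv xcoeff_x_deriv)
qed

lemma degree_bounded_nonneg_part:
  assumes "degree_bounded d f"
  shows "degree_bounded d (nonneg_part f)"
proof -
  have "fps_nth (nonneg_part f) n = 0" if "fps_nth f n = 0" for n
    by (rule poly_mapping_eqI) (simp add: nonneg_part_def lookup_restrict_keys that)
  then show ?thesis
    using assms by (auto simp: degree_bounded_def supp_in_iff xcoeff_nonneg_part)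
qed

lemma nonneg_part_mult_commute:
  fixes f p :: "'a::comm_ring_1 laurent fps"
  assumes supp_p: "supp_in {- int d..int d} p" and gap: "supp_in (- {- int d..int d}) f"
  shows "nonneg_part (p * f) = p * nonneg_part f"
proof (rule laurent_fps_eqI)
  fix k
  let ?neg = "f - nonneg_part f"
  have "supp_in {int d<..} (nonneg_part f)" "supp_in {..<- int d} ?neg"
    using gap by (auto simp: supp_in_iff xcoeff_nonneg_part xcoeff_diff)
  then have nonneg: "supp_in {0..} (p * nonneg_part f)" and neg: "supp_in {..<0} (p * ?neg)"
    using supp_in_mult[OF supp_p, of _ "nonneg_part f" "{0..}"]
      supp_in_mult[OF supp_p, of _ ?neg "{..<0}"]
    by fastforce+
  have "p * f = p * nonneg_part f + p * ?neg"
    by (simp add: algebra_simps)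
  then have "xcoeff k (p * f) = xcoeff k (p * nonneg_part f) + xcoeff k (p * ?neg)"
    by (simp only: xcoeff_add)
  then show "xcoeff k (nonneg_part (p * f)) = xcoeff k (p * nonneg_part f)"
    using nonneg neg by (auto simp: xcoeff_nonneg_part supp_in_iff)
qed

lemma rat_span_bounded_mult:
  assumes "degree_bounded d u" "f \<in> rat_span H"
  shows "u * f \<in> rat_span H"
proof -
  obtain p where "u = fps_of_poly p" using assms(1) by (rule degree_bounded_imp_poly)
  then show ?thesis using assms(2) by (simp add: rat_span_poly_mult)
qed

text \<open>The terms of \<open>f\<close> with exponents of \<open>x\<close> beyond the degree of \<open>p\<close> do not contribute.\<close>

lemma nonneg_part_commutator:
  fixes f p :: "'a::idom laurent fps"
  assumes bounded_p: "degree_bounded d p"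
    and coeffs: "\<And>k. k \<in> {- int d..int d} \<Longrightarrow> fps_lift (xcoeff k f) \<in> rat_span H"
  shows "p * nonneg_part f - nonneg_part (p * f) \<in> rat_span H"
proof -
  let ?K = "{- int d..int d}"
  define near where "near = (\<Sum>k\<in>?K. x_monom k * fps_lift (xcoeff k f))"
  define far where "far = f - near"
  have "xcoeff k near = (if k \<in> ?K then xcoeff k f else 0)" for k
    by (auto simp: near_def xcoeff_sum xcoeff_x_monom_mult xcoeff_lift eq_diff_eq cong: if_cong)
  then have "supp_in (- ?K) far"
    by (auto simp: supp_in_iff far_def xcoeff_diff)
  then have far_commutes: "nonneg_part (p * far) = p * nonneg_part far"
    using bounded_p by (intro nonneg_part_mult_commute) (auto simp: degree_bounded_def)
  have "f = near + far" by (simp add: far_def)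
  then have "p * nonneg_part f - nonneg_part (p * f) =
      p * nonneg_part near - nonneg_part (p * near)"
    by (simp add: distrib_left nonneg_part_add far_commutes)
  also have "\<dots> = (\<Sum>k\<in>?K. p * nonneg_part (x_monom k) * fps_lift (xcoeff k f) -
      nonneg_part (p * x_monom k) * fps_lift (xcoeff k f))"
    by (simp add: near_def nonneg_part_sum sum_distrib_left sum_subtractf nonneg_part_mult_lift
        mult.assoc[symmetric])
  also have "\<dots> \<in> rat_span H"
  proof (intro rat_span_sum rat_span_diff)
    fix k assume k_range: "k \<in> ?K"
    have "degree_bounded (d + nat \<bar>k\<bar>) (p * nonneg_part (x_monom k))"
        "degree_bounded (d + nat \<bar>k\<bar>) (nonneg_part (p * x_monom k))"
      by (intro degree_bounded_mult degree_bounded_nonneg_part degree_bounded_x_monom bounded_p)+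
    then show "p * nonneg_part (x_monom k) * fps_lift (xcoeff k f) \<in> rat_span H"
        "nonneg_part (p * x_monom k) * fps_lift (xcoeff k f) \<in> rat_span H"
      using coeffs[OF k_range] by (auto intro: rat_span_bounded_mult)
  qed
  finally show ?thesis .
qed

lemma (in bounded_derivs) nonneg_part_derivative_in_rat_span:
  assumes xt: "\<delta> \<in> xt_derivs" and h_in_G: "h \<in> G" and nonneg: "nonneg_part ` G \<subseteq> rat_span H"
    and coeffs: "\<And>k f. k \<in> {- int D..int D} \<Longrightarrow> f \<in> insert (\<delta> h) G \<Longrightarrow>
      fps_lift (xcoeff k f) \<in> rat_span H"
  shows "\<delta> (nonneg_part h) \<in> rat_span H"
proof -
  obtain p where combination: "\<And>g. g \<in> G \<Longrightarrow> degree_bounded D (p g)" "q * \<delta> h = (\<Sum>g\<in>G. p g * g)"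
    using derivs_bounded[OF xt h_in_G] unfolding bounded_span_def by blast
  obtain r where q_poly: "q = fps_of_poly r"
    using q_bounded by (rule degree_bounded_imp_poly)
  have "nonneg_part (p g * g) \<in> rat_span H" if g_in_G: "g \<in> G" for g
  proof -
    have "p g * nonneg_part g - (p g * nonneg_part g - nonneg_part (p g * g)) \<in> rat_span H"
      using nonneg g_in_G
      by (intro rat_span_diff rat_span_bounded_mult[OF combination(1)]
          nonneg_part_commutator[OF combination(1)] coeffs) auto
    then show ?thesis by simp
  qed
  then have "nonneg_part (q * \<delta> h) \<in> rat_span H"
    unfolding combination(2) nonneg_part_sum by (intro rat_span_sum)
  moreover have "q * nonneg_part (\<delta> h) - nonneg_part (q * \<delta> h) \<in> rat_span H"
    by (intro nonneg_part_commutator[OF q_bounded] coeffs) simp_all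
  ultimately have "q * nonneg_part (\<delta> h) \<in> rat_span H"
    using rat_span_add[of "q * nonneg_part (\<delta> h) - nonneg_part (q * \<delta> h)" H] by fastforce
  then have "fps_of_poly r * \<delta> (nonneg_part h) \<in> rat_span H"
    by (simp add: nonneg_part_deriv[OF xt] q_poly)
  then show ?thesis
    by (rule rat_span_cancel_poly[rotated]) (use q_nonzero q_poly in auto)
qed

lemma deriv_closed_coefficients:
  fixes G :: "'a::field_char_0 laurent fps set"
  assumes "deriv_closed xt_derivs G" "finite K"
  obtains U where "deriv_closed {fps_deriv} U" "\<And>k g. k \<in> K \<Longrightarrow> g \<in> G \<Longrightarrow> xcoeff k g \<in> U"
proof -
  have "D_finite xt_derivs g" if "g \<in> G" for g
    using partial_derivation_xt assms(1) that by (rule D_finite_if_in_deriv_closed)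
  then have D_finite: "D_finite {fps_deriv} f" if "f \<in> (\<lambda>(k, g). xcoeff k g) ` (K \<times> G)" for f
    using that by (auto intro: D_finite_xcoeff)
  have "finite ((\<lambda>(k, g). xcoeff k g) ` (K \<times> G))"
    using assms by (simp add: deriv_closed_def)
  then obtain U where "deriv_closed {fps_deriv} U" "(\<lambda>(k, g). xcoeff k g) ` (K \<times> G) \<subseteq> U"
    using D_finite by (rule D_finite_common_deriv_closed)
  then show ?thesis
    by (intro that) auto
qed

lemma D_finite_nonneg_part:
  fixes f :: "'a::field_char_0 laurent fps"
  assumes "D_finite xt_derivs f"
  shows "D_finite xt_derivs (nonneg_part f)"
proof -
  obtain G where closed: "deriv_closed xt_derivs G" "f \<in> G"
    using assms by (rule D_finiteE)
  obtain q D where "bounded_derivs G q D"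
    using closed(1) by (rule deriv_closed_bounded_derivs)
  interpret bounded_derivs G q D by fact
  obtain U where closed_U: "deriv_closed {fps_deriv} U"
    and coeff_U: "\<And>k g. k \<in> {- int D..int D + 1} \<Longrightarrow> g \<in> G \<Longrightarrow> xcoeff k g \<in> U"
    using deriv_closed_coefficients[OF closed(1), of "{- int D..int D + 1}"] by auto
  define H where "H = nonneg_part ` G \<union> fps_lift ` U"
  have lift_U: "fps_lift u \<in> rat_span H" if "u \<in> rat_span U" for u
    using rat_span_lift[OF that] closed_U rat_span_mono[of "fps_lift ` U" H]
    by (auto simp: H_def deriv_closed_def)
  have coeffs: "fps_lift (xcoeff k g) \<in> rat_span H"
    if "\<delta> \<in> xt_derivs" "h \<in> G" "k \<in> {- int D..int D}" "g \<in> insert (\<delta> h) G" for \<delta> h k g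
  proof (rule lift_U)
    have "xcoeff k (x_deriv h) = fps_of_poly [:of_int (k + 1):] * xcoeff (k + 1) h"
      by (simp add: xcoeff_x_deriv fps_of_poly_const)
    also have "\<dots> \<in> rat_span U"
      using that by (intro rat_span_poly_mult rat_span_base coeff_U) auto
    finally show "xcoeff k g \<in> rat_span U"
      using that closed_U coeff_U[of k]
      by (auto simp: xcoeff_fps_deriv deriv_closed_def intro: rat_span_base)
  qed
  have "\<delta> (nonneg_part h) \<in> rat_span H" if "\<delta> \<in> xt_derivs" "h \<in> G" for \<delta> h
    by (rule nonneg_part_derivative_in_rat_span[OF that _ coeffs[OF that]])
       (auto simp: H_def intro: rat_span_base)
  moreover have "deriv_closed xt_derivs (fps_lift ` U)"
    using closed_U derivs_lift_t_xt by (rule deriv_closed_lift)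
  ultimately have "deriv_closed xt_derivs H"
    using finite_G rat_span_mono[of "fps_lift ` U" H] unfolding deriv_closed_def H_def by blast
  with partial_derivation_xt show ?thesis
    by (rule D_finite_if_in_deriv_closed) (use closed(2) in \<open>simp_all add: H_def\<close>)
qed


subsection \<open>The logarithms of the factors\<close>

context walk_factorization
begin

abbreviation log_B0 :: "real fps" where
  "log_B0 \<equiv> fps_log id B0"

abbreviation log_Bp :: "real laurent fps" where
  "log_Bp \<equiv> fps_log laurent_const Bp"

abbreviation log_Bm :: "real laurent fps" where
  "log_Bm \<equiv> fps_log laurent_const Bm"

abbreviation log_B :: "real laurent fps" where
  "log_B \<equiv> fps_lift log_B0 + log_Bp + log_Bm"

lemma is_log_B0: "is_log B0 log_B0"
  using B0_nth_0 by (intro is_log_fps_log) (unfold_locales, simp_all)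

lemma is_log_Bp: "is_log Bp log_Bp"
  using comm_ring_hom_laurent_const Bp_nth_0 by (rule is_log_fps_log)

lemma is_log_Bm: "is_log Bm log_Bm"
  using comm_ring_hom_laurent_const Bm_nth_0 by (rule is_log_fps_log)

lemma supp_log_Bp: "supp_in {0..} log_Bp"
  and xcoeff_0_log_Bp: "xcoeff 0 log_Bp = 0"
  using is_log_supp[OF is_log_Bp _ supp_Bp xcoeff_0_Bp] by auto

lemma supp_log_Bm: "supp_in {..0} log_Bm"
  and xcoeff_0_log_Bm: "xcoeff 0 log_Bm = 0"
  using is_log_supp[OF is_log_Bm _ supp_Bm xcoeff_0_Bm] by auto

lemma D_finite_log_B: "D_finite xt_derivs log_B"
  using finite_steps
  by (rule D_finite_log_bilateral)
     (unfold bilateral_gf_eq, intro is_log_mult is_log_lift is_log_B0 is_log_Bp is_log_Bm)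

lemma xcoeff_0_log_B: "xcoeff 0 log_B = log_B0"
  by (simp add: xcoeff_add xcoeff_lift xcoeff_0_log_Bp xcoeff_0_log_Bm)

lemma nonneg_part_log_B: "nonneg_part log_B = fps_lift log_B0 + log_Bp"
proof (rule laurent_fps_eqI)
  fix k
  have "xcoeff k log_Bm = 0" if "k \<ge> 0"
    using that supp_log_Bm xcoeff_0_log_Bm by (cases "k = 0") (auto simp: supp_in_iff)
  moreover have "xcoeff k log_Bp = 0" if "k < 0"
    using that supp_log_Bp by (auto simp: supp_in_iff)
  ultimately show "xcoeff k (nonneg_part log_B) = xcoeff k (fps_lift log_B0 + log_Bp)"
    by (auto simp: xcoeff_nonneg_part xcoeff_add xcoeff_lift)
qed

lemma D_finite_log_B0: "D_finite {fps_deriv} log_B0"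
  using D_finite_xcoeff[OF D_finite_log_B, of 0] by (simp only: xcoeff_0_log_B)

lemma D_finite_lift_log_B0: "D_finite xt_derivs (fps_lift log_B0)"
  by (rule D_finite_lift[OF D_finite_log_B0 derivs_lift_t_xt partial_derivation_xt])

lemma D_finite_log_Bp: "D_finite xt_derivs log_Bp"
proof -
  have "D_finite xt_derivs (nonneg_part log_B - fps_lift log_B0)"
    by (intro D_finite_diff D_finite_nonneg_part D_finite_log_B D_finite_lift_log_B0
        ratfun_derivation_if_partial partial_derivation_xt)
  then show ?thesis
    by (simp add: nonneg_part_log_B)
qed

lemma D_finite_log_Bm: "D_finite xt_derivs log_Bm"
proof -
  have "D_finite xt_derivs (log_B - nonneg_part log_B)"
    by (intro D_finite_diff D_finite_nonneg_part D_finite_log_B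
        ratfun_derivation_if_partial partial_derivation_xt)
  then show ?thesis
    by (simp add: nonneg_part_log_B)
qed

lemma D_finite_log_slit_walks:
  "D_finite xyt_derivs (fps_log (laurent_const \<circ> laurent_const) (gf_xy (slit_walks \<SS>)))"
proof -
  let ?log = "fps_log (laurent_const \<circ> laurent_const) :: real laurent laurent fps \<Rightarrow> _"
  let ?S = "gf_xy (slit_walks \<SS>)" and ?K = "walk_kernel \<SS>"
  have hom: "comm_ring_hom (laurent_const \<circ> laurent_const :: real \<Rightarrow> _)"
    by unfold_locales (simp_all add: laurent_const.hom_add laurent_const.hom_mult)
  have "fps_nth ?S 0 = 1"
    using arg_cong[OF gf_slit_walks, of "\<lambda>f. fps_nth f 0"] B0_nth_0 Bm_nth_0 by simp
  then have "is_log (?S * (?K * fps_lift (fps_lift B0) * fps_lift Bm))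
      (?log ?S + (?log ?K + fps_lift (fps_lift log_B0) + fps_lift log_Bm))"
    by (intro is_log_mult is_log_lift is_log_fps_log[OF hom] is_log_B0 is_log_Bm) simp_all
  then have "?log ?S + (?log ?K + fps_lift (fps_lift log_B0) + fps_lift log_Bm) = 0"
    using is_log_unique[OF _ is_log_1] by (simp add: gf_slit_walks)
  then have log_S: "?log ?S = - ?log ?K - fps_lift (fps_lift log_B0) - fps_lift log_Bm"
    by (simp add: eq_neg_iff_add_eq_0 algebra_simps)
  have "D_finite xyt_derivs (?log ?K)"
    by (rule D_finite_log_walk_kernel[OF is_log_fps_log[OF hom]]) simp
  then show ?thesis
    unfolding log_S
    by (intro D_finite_diff D_finite_uminus D_finite_lift_log_B0 D_finite_log_Bm
        D_finite_lift[OF _ derivs_lift_xt_xyt partial_derivation_xyt]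
        ratfun_derivation_if_partial partial_derivation_xyt)
qed

end

theorem theorem5p2:
  fixes \<SS> :: "(int \<times> int) set"
    and B0 :: "real fps" and Bp Bm :: "real laurent fps"
  assumes "finite \<SS>"
    and "canonical_factorization (gf_x (bilateral_walks \<SS>)) B0 Bp Bm"
  shows "gf_t (loops \<SS>) = B0 \<and>
    gf_x (bilateral_slit_walks \<SS>) = Bp \<and>
    gf_xy (slit_walks \<SS>) * (walk_kernel \<SS> * fps_lift (fps_lift B0) * fps_lift Bm) = 1 \<and>
    D_finite_t (fps_log id (gf_t (loops \<SS>))) \<and>
    D_finite_xt (fps_log laurent_const (gf_x (bilateral_slit_walks \<SS>))) \<and>
    D_finite_xyt (fps_log (laurent_const \<circ> laurent_const) (gf_xy (slit_walks \<SS>)))"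
proof -
  interpret walk_factorization \<SS> B0 Bp Bm
    using assms by unfold_locales
  show ?thesis
    unfolding D_finite_t_def D_finite_xt_def D_finite_xyt_def gf_loops gf_bilateral_slit_walks
    by (intro conjI refl gf_slit_walks D_finite_log_B0 D_finite_log_Bp D_finite_log_slit_walks)
qed

end
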